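(* Let $X$ be any finite set of permutations. Then the classes $\mathcal{I}_2 \cap \mathrm{Av}(X)$ and $\mathcal{I}_2 \cap \mathrm{Av}(\mathrm{red}(X))$ have the same growth rate, i.e. $s(\mathcal{I}_2 \cap \mathrm{Av}(X)) = s(\mathcal{I}_2 \cap \mathrm{Av}(\mathrm{red}(X)))$.
   Context: Permutations are finite and the empty permutation is allowed. A permutation $\alpha$ is involved in (contained in) $\pi$, written $\alpha \preceq \pi$, if $\pi$ has a subsequence order-isomorphic to $\alpha$; otherwise $\pi$ avoids $\alpha$. For a set $B$ of permutations, $\mathrm{Av}(B)$ is the set of all permutations avoiding every element of $B$. $\mathcal{I}_2 = \mathrm{Av}(321)$. $\mathcal{S}_n$ is the set of permutations of length $n$. The growth rate of a class $\mathcal{C}$ is $s(\mathcal{C}) = \limsup_{n\to\infty} |\mathcal{C}\cap \mathcal{S}_n|^{1/n}$. The direct sum $\alpha\oplus\beta$ is the permutation of length $|\alpha|+|\beta|$ whose first $|\alpha|$ positions carry the values $1,\dots,|\alpha|$ in the pattern $\alpha$ and whose remaining positions carry the remaining values in the pattern $\beta$. A permutation is plus indecomposable if it is not $\alpha\oplus\beta$ for any non-empty $\alpha,\beta$. Let $1^m$ denote the direct sum of $m\ge 0$ copies of the permutation of length 1. Every permutation $\pi$ can be written as $\pi = 1^{m_0}\oplus\rho_1\oplus 1^{m_1}\oplus\rho_2\oplus\cdots\oplus 1^{m_{c-1}}\oplus\rho_c\oplus 1^{m_c}$ for a unique sequence $\rho_1,\dots,\rho_c$ ($c \ge 0$) of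 plus indecomposable permutations each of length at least 2 and $m_i\ge 0$; the rigid reduction of $\pi$ is $\mathrm{red}(\pi)=\rho_1\oplus\rho_2\oplus\cdots\oplus\rho_c$ (the empty permutation if $c=0$). For a set $X$ of permutations, $\mathrm{red}(X)=\{\mathrm{red}(\pi) : \pi\in X\}$. *)

theory Defs
  imports "HOL-Analysis.Analysis" "HOL-Combinatorics.Multiset_Permutations" "HOL-Library.Sublist"
begin

text \<open>Permutations are in one-line notation: a permutation of length \<open>n\<close> is a list
  containing each of \<open>1, \<dots>, n\<close> exactly once.\<close>

definition perms_of_length :: "nat \<Rightarrow> nat list set" where
  "perms_of_length n = permutations_of_set {1..n}"

definition perms :: "nat list set" where
  "perms = (\<Union>n. perms_of_length n)"

definition order_isomorphic :: "nat list \<Rightarrow> nat list \<Rightarrow> bool" where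
  "order_isomorphic xs ys \<longleftrightarrow> length xs = length ys \<and>
     (\<forall>i<length xs. \<forall>j<length xs. xs ! i < xs ! j \<longleftrightarrow> ys ! i < ys ! j)"

definition involved :: "nat list \<Rightarrow> nat list \<Rightarrow> bool" (infix "\<preceq>\<^sub>p" 50) where
  "\<alpha> \<preceq>\<^sub>p \<pi> \<longleftrightarrow> (\<exists>\<tau>. subseq \<tau> \<pi> \<and> order_isomorphic \<tau> \<alpha>)"

definition Av :: "nat list set \<Rightarrow> nat list set" where
  "Av B = {\<pi> \<in> perms. \<forall>\<beta>\<in>B. \<not> \<beta> \<preceq>\<^sub>p \<pi>}"

definition I2 :: "nat list set" where
  "I2 = Av {[3, 2, 1]}"

text \<open>The growth rate is an extended real, so that the limit superior needs no boundedness
  assumption. The value of the sequence at \<open>n = 0\<close> is irrelevant.\<close>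

definition growth_rate :: "nat list set \<Rightarrow> ereal" where
  "growth_rate C = limsup (\<lambda>n. ereal (root n (real (card (C \<inter> perms_of_length n)))))"

definition dsum :: "nat list \<Rightarrow> nat list \<Rightarrow> nat list" (infixr "\<oplus>\<^sub>p" 65) where
  "\<alpha> \<oplus>\<^sub>p \<beta> = \<alpha> @ map (\<lambda>v. length \<alpha> + v) \<beta>"

definition dsum_list :: "nat list list \<Rightarrow> nat list" where
  "dsum_list \<rho>s = foldr (\<oplus>\<^sub>p) \<rho>s []"

definition ones :: "nat \<Rightarrow> nat list" where
  "ones m = dsum_list (replicate m [1])"

definition plus_indecomposable :: "nat list \<Rightarrow> bool" where
  "plus_indecomposable \<pi> \<longleftrightarrow>
     \<not> (\<exists>\<alpha>\<in>perms. \<exists>\<beta>\<in>perms. \<alpha> \<noteq> [] \<and> \<beta> \<noteq> [] \<and> \<pi> = \<alpha> \<oplus>\<^sub>p \<beta>)"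

text \<open>With \<open>ps = [(m\<^sub>0, \<rho>\<^sub>1), \<dots>, (m\<^bsub>c-1\<^esub>, \<rho>\<^sub>c)]\<close> and \<open>m = m\<^sub>c\<close>, this says that
  \<open>\<pi>\<close> is \<open>1\<^bsup>m\<^sub>0\<^esup> \<oplus> \<rho>\<^sub>1 \<oplus> \<dots> \<oplus> 1\<^bsup>m\<^bsub>c-1\<^esub>\<^esup> \<oplus> \<rho>\<^sub>c \<oplus> 1\<^bsup>m\<^sub>c\<^esup>\<close> with each \<open>\<rho>\<^sub>i\<close> plus indecomposable of
  length at least 2.\<close>

definition rigid_decomp :: "nat list \<Rightarrow> (nat \<times> nat list) list \<Rightarrow> nat \<Rightarrow> bool" where
  "rigid_decomp \<pi> ps m \<longleftrightarrow>
     (\<forall>(k, \<rho>)\<in>set ps. \<rho> \<in> perms \<and> plus_indecomposable \<rho> \<and> length \<rho> \<ge> 2) \<and>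
     \<pi> = foldr (\<lambda>(k, \<rho>) \<sigma>. ones k \<oplus>\<^sub>p \<rho> \<oplus>\<^sub>p \<sigma>) ps (ones m)"

definition rigid_components :: "nat list \<Rightarrow> nat list list" where
  "rigid_components \<pi> = (THE \<rho>s. \<exists>ps m. rigid_decomp \<pi> ps m \<and> \<rho>s = map snd ps)"

definition red :: "nat list \<Rightarrow> nat list" where
  "red \<pi> = dsum_list (rigid_components \<pi>)"


text \<open>The remaining lemmas show that the description in \<open>rigid_components\<close> is proper:
  every permutation has exactly one sequence of rigid components.\<close>

lemma perms_iff: "\<pi> \<in> perms \<longleftrightarrow> distinct \<pi> \<and> set \<pi> = {1..length \<pi>}"
proof -
  have "n = length \<pi>" if "set \<pi> = {1..n}" "distinct \<pi>" for n
    using that distinct_card[of \<pi>] by simp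
  then show ?thesis
    unfolding perms_def perms_of_length_def permutations_of_set_def by blast
qed

lemma dsum_Nil [simp]: "[] \<oplus>\<^sub>p \<beta> = \<beta>" "\<alpha> \<oplus>\<^sub>p [] = \<alpha>"
  by (simp_all add: dsum_def)

lemma length_dsum [simp]: "length (\<alpha> \<oplus>\<^sub>p \<beta>) = length \<alpha> + length \<beta>"
  by (simp add: dsum_def)

lemma dsum_assoc: "(\<alpha> \<oplus>\<^sub>p \<beta>) \<oplus>\<^sub>p \<gamma> = \<alpha> \<oplus>\<^sub>p \<beta> \<oplus>\<^sub>p \<gamma>"
  by (simp add: dsum_def add.assoc)

lemma dsum_list_simps [simp]:
  "dsum_list [] = []" "dsum_list (\<rho> # \<rho>s) = \<rho> \<oplus>\<^sub>p dsum_list \<rho>s"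
  by (simp_all add: dsum_list_def)

lemma dsum_list_append: "dsum_list (xs @ ys) = dsum_list xs \<oplus>\<^sub>p dsum_list ys"
  by (induction xs) (simp_all add: dsum_assoc)

lemma shifted_perm:
  assumes "\<alpha> \<in> perms" "\<alpha> @ map (\<lambda>v. length \<alpha> + v) \<beta> \<in> perms"
  shows "\<beta> \<in> perms"
proof -
  let ?f = "\<lambda>v. length \<alpha> + v"
  have d: "distinct \<beta>" and disj: "set \<alpha> \<inter> ?f ` set \<beta> = {}"
    using assms by (auto simp: perms_iff distinct_map)
  have u: "{1..length \<alpha>} \<union> ?f ` set \<beta> = {1..length \<alpha> + length \<beta>}"
    using assms by (simp add: perms_iff)
  have "v \<in> {1..length \<beta>}" if "v \<in> set \<beta>" for v
  proof -
    have "?f v \<in> {1..length \<alpha> + length \<beta>}" using u that by blast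
    moreover have "?f v \<notin> {1..length \<alpha>}" using disj that assms(1) by (auto simp: perms_iff)
    ultimately show ?thesis by auto
  qed
  then have "set \<beta> \<subseteq> {1..length \<beta>}" by blast
  moreover have "card (set \<beta>) = card {1..length \<beta>}" using d by (simp add: distinct_card)
  ultimately have "set \<beta> = {1..length \<beta>}" by (simp add: card_subset_eq)
  with d show ?thesis by (simp add: perms_iff)
qed

lemma dsum_perms:
  assumes "\<alpha> \<in> perms" "\<beta> \<in> perms"
  shows "\<alpha> \<oplus>\<^sub>p \<beta> \<in> perms"
proof -
  let ?f = "\<lambda>v. length \<alpha> + v"
  have im: "?f ` set \<beta> = {length \<alpha> + 1..length \<alpha> + length \<beta>}"
    using assms(2) by (simp add: perms_iff)
  have un: "{1..length \<alpha>} \<union> {length \<alpha> + 1..length \<alpha> + length \<beta>} = {1..length \<alpha> + length \<beta>}"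
    by auto
  have di: "{1..length \<alpha>} \<inter> {length \<alpha> + 1..length \<alpha> + length \<beta>} = {}" by auto
  have "set (\<alpha> \<oplus>\<^sub>p \<beta>) = {1..length (\<alpha> \<oplus>\<^sub>p \<beta>)}"
    using assms(1) un im by (simp only: dsum_def set_append set_map perms_iff length_append length_map)
  moreover have "distinct (\<alpha> \<oplus>\<^sub>p \<beta>)"
  proof -
    have "distinct (map ?f \<beta>)" using assms(2) by (simp add: perms_iff distinct_map)
    moreover have "set \<alpha> \<inter> set (map ?f \<beta>) = {}"
      using assms(1) di im by (simp only: set_map perms_iff)
    ultimately show ?thesis using assms(1) by (simp add: dsum_def perms_iff)
  qed
  ultimately show ?thesis by (simp only: perms_iff)
qed

lemma Nil_perms [simp]: "[] \<in> perms" and one_perms [simp]: "[Suc 0] \<in> perms"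
  by (simp_all add: perms_iff)

lemma dsum_list_perms: "set \<rho>s \<subseteq> perms \<Longrightarrow> dsum_list \<rho>s \<in> perms"
  by (induction \<rho>s) (simp_all add: dsum_perms)

lemma one_indecomposable: "plus_indecomposable [Suc 0]"
proof -
  have False if "\<alpha> \<noteq> []" "\<beta> \<noteq> []" "[Suc 0] = \<alpha> \<oplus>\<^sub>p \<beta>" for \<alpha> \<beta>
    using that by (cases \<alpha>; cases \<beta>) (simp_all add: dsum_def)
  then show ?thesis unfolding plus_indecomposable_def by blast
qed

definition indec :: "nat list \<Rightarrow> bool" where
  "indec \<rho> \<longleftrightarrow> \<rho> \<in> perms \<and> \<rho> \<noteq> [] \<and> plus_indecomposable \<rho>"

lemma indec_prefix:
  assumes "indec a" "indec b" "s \<in> perms" "t \<in> perms" "a \<oplus>\<^sub>p s = b \<oplus>\<^sub>p t"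
  shows "\<not> length a < length b"
proof
  assume lt: "length a < length b"
  define r where "r = take (length b - length a) s"
  have "b = take (length b) (b \<oplus>\<^sub>p t)" by (simp add: dsum_def)
  also have "\<dots> = a @ map (\<lambda>v. length a + v) r"
    using lt unfolding assms(5)[symmetric] by (simp add: dsum_def r_def take_map)
  finally have b: "b = a @ map (\<lambda>v. length a + v) r" .
  then have "r \<in> perms" using shifted_perm[of a r] assms(1,2) by (simp add: indec_def)
  moreover have "r \<noteq> []" using b lt by auto
  moreover have "b = a \<oplus>\<^sub>p r" using b by (simp add: dsum_def)
  ultimately show False
    using assms(1,2) unfolding indec_def plus_indecomposable_def by blast
qed

lemma indec_cancel:
  assumes "indec a" "indec b" "s \<in> perms" "t \<in> perms" "a \<oplus>\<^sub>p s = b \<oplus>\<^sub>p t"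
  shows "a = b" "s = t"
proof -
  have l: "length a = length b"
    using indec_prefix[OF assms] indec_prefix[OF assms(2,1,4,3) assms(5)[symmetric]] by simp
  then have *: "a = b \<and> map (\<lambda>v. length a + v) s = map (\<lambda>v. length a + v) t"
    using assms(5) by (simp add: dsum_def)
  then show "a = b" by simp
  have "inj (\<lambda>v. length a + v)" by (simp add: inj_def)
  then show "s = t" using * inj_map_eq_map by blast
qed

lemma indec_list_unique:
  assumes "\<forall>\<rho>\<in>set xs. indec \<rho>" "\<forall>\<rho>\<in>set ys. indec \<rho>" "dsum_list xs = dsum_list ys"
  shows "xs = ys"
  using assms
proof (induction xs arbitrary: ys)
  case Nil
  then show ?case by (cases ys) (auto simp: indec_def dsum_def)
next
  case (Cons a xs)
  show ?case
  proof (cases ys)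
    case Nil
    then show ?thesis using Cons.prems by (auto simp: indec_def dsum_def)
  next
    case ys: (Cons b zs)
    have p: "dsum_list xs \<in> perms" "dsum_list zs \<in> perms"
      using Cons.prems ys by (auto intro!: dsum_list_perms simp: indec_def)
    have "a = b" "dsum_list xs = dsum_list zs"
      using indec_cancel[of a b, OF _ _ p] Cons.prems ys by auto
    moreover from this have "xs = zs"
      using Cons.IH[of zs] Cons.prems(1,2) ys by simp
    ultimately show ?thesis using ys by simp
  qed
qed

lemma indec_list_exists:
  "\<pi> \<in> perms \<Longrightarrow> \<exists>xs. (\<forall>\<rho>\<in>set xs. indec \<rho>) \<and> dsum_list xs = \<pi>"
proof (induction "length \<pi>" arbitrary: \<pi> rule: less_induct)
  case less
  consider "\<pi> = []" | "indec \<pi>"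
    | \<alpha> \<beta> where "\<alpha> \<in> perms" "\<beta> \<in> perms" "\<alpha> \<noteq> []" "\<beta> \<noteq> []" "\<pi> = \<alpha> \<oplus>\<^sub>p \<beta>"
    using less.prems unfolding indec_def plus_indecomposable_def by blast
  then show ?case
  proof cases
    case 1
    then show ?thesis by (intro exI[of _ "[]"]) simp
  next
    case 2
    then show ?thesis by (intro exI[of _ "[\<pi>]"]) simp
  next
    case 3
    obtain xs where "\<forall>\<rho>\<in>set xs. indec \<rho>" "dsum_list xs = \<alpha>"
      using less.hyps[of \<alpha>] 3 by auto
    moreover obtain ys where "\<forall>\<rho>\<in>set ys. indec \<rho>" "dsum_list ys = \<beta>"
      using less.hyps[of \<beta>] 3 by auto
    ultimately show ?thesis
      using 3 by (intro exI[of _ "xs @ ys"]) (auto simp: dsum_list_append)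
  qed
qed

definition flat :: "(nat \<times> nat list) list \<Rightarrow> nat \<Rightarrow> nat list list" where
  "flat ps m = concat (map (\<lambda>(k, \<rho>). replicate k [1] @ [\<rho>]) ps) @ replicate m [1]"

lemma dsum_list_flat:
  "dsum_list (flat ps m) = foldr (\<lambda>(k, \<rho>) \<sigma>. ones k \<oplus>\<^sub>p \<rho> \<oplus>\<^sub>p \<sigma>) ps (ones m)"
  by (induction ps) (auto simp: flat_def ones_def dsum_list_append dsum_assoc)

lemma filter_flat:
  "\<forall>(k, \<rho>)\<in>set ps. length \<rho> \<ge> 2 \<Longrightarrow>
     filter (\<lambda>\<rho>. length \<rho> \<ge> 2) (flat ps m) = map snd ps"
  by (induction ps) (auto simp: flat_def)

lemma indec_flat:
  "rigid_decomp \<pi> ps m \<Longrightarrow> \<forall>\<rho>\<in>set (flat ps m). indec \<rho>"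
proof -
  assume d: "rigid_decomp \<pi> ps m"
  have "indec \<rho>" if "(k, \<rho>) \<in> set ps" for k \<rho>
  proof -
    have "\<rho> \<in> perms \<and> plus_indecomposable \<rho> \<and> length \<rho> \<ge> 2"
      using d that unfolding rigid_decomp_def by blast
    then show ?thesis by (auto simp: indec_def)
  qed
  moreover have "indec [Suc 0]" by (simp add: indec_def one_indecomposable)
  ultimately show ?thesis by (auto simp: flat_def)
qed

lemma flat_exists:
  assumes "\<forall>\<rho>\<in>set xs. indec \<rho>"
  shows "\<exists>ps m. xs = flat ps m \<and> (\<forall>(k, \<rho>)\<in>set ps. indec \<rho> \<and> length \<rho> \<ge> 2)"
  using assms
proof (induction xs)
  case Nil
  then show ?case by (intro exI[of _ "[]"] exI[of _ 0]) (simp add: flat_def)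
next
  case (Cons a xs)
  then obtain ps m where
    IH: "xs = flat ps m" "\<forall>(k, \<rho>)\<in>set ps. indec \<rho> \<and> length \<rho> \<ge> 2" by auto
  show ?case
  proof (cases "length a \<ge> 2")
    case True
    then show ?thesis using IH Cons.prems
      by (intro exI[of _ "(0, a) # ps"] exI[of _ m]) (auto simp: flat_def)
  next
    case False
    have "a \<in> perms" "a \<noteq> []" using Cons.prems by (auto simp: indec_def)
    with False have a: "a = [1]" by (cases a) (auto simp: perms_iff Suc_le_eq)
    show ?thesis
    proof (cases ps)
      case Nil
      then show ?thesis using IH a
        by (intro exI[of _ "[]"] exI[of _ "Suc m"]) (auto simp: flat_def)
    next
      case (Cons p qs)
      then show ?thesis using IH a
        by (intro exI[of _ "(Suc (fst p), snd p) # qs"] exI[of _ m])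
           (auto simp: flat_def split: prod.splits)
    qed
  qed
qed

lemma rigid_components_ex1:
  assumes "\<pi> \<in> perms"
  shows "\<exists>!\<rho>s. \<exists>ps m. rigid_decomp \<pi> ps m \<and> \<rho>s = map snd ps"
proof (rule ex_ex1I)
  obtain xs where xs: "\<forall>\<rho>\<in>set xs. indec \<rho>" "dsum_list xs = \<pi>"
    using indec_list_exists[OF assms] by blast
  obtain ps m where "xs = flat ps m" "\<forall>(k, \<rho>)\<in>set ps. indec \<rho> \<and> length \<rho> \<ge> 2"
    using flat_exists[OF xs(1)] by blast
  then have "rigid_decomp \<pi> ps m"
    using xs(2) by (auto simp: rigid_decomp_def dsum_list_flat indec_def)
  then show "\<exists>\<rho>s ps m. rigid_decomp \<pi> ps m \<and> \<rho>s = map snd ps" by blast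
next
  fix \<rho>s \<rho>s'
  assume "\<exists>ps m. rigid_decomp \<pi> ps m \<and> \<rho>s = map snd ps"
    "\<exists>ps m. rigid_decomp \<pi> ps m \<and> \<rho>s' = map snd ps"
  then obtain ps m ps' m' where
    d: "rigid_decomp \<pi> ps m" "\<rho>s = map snd ps" "rigid_decomp \<pi> ps' m'" "\<rho>s' = map snd ps'"
    by blast
  have "flat ps m = flat ps' m'"
    using indec_list_unique[OF indec_flat[OF d(1)] indec_flat[OF d(3)]] d
    by (simp add: dsum_list_flat rigid_decomp_def)
  moreover have "filter (\<lambda>\<rho>. length \<rho> \<ge> 2) (flat ps m) = \<rho>s"
    unfolding d(2) by (rule filter_flat) (use d(1) in \<open>auto simp: rigid_decomp_def\<close>)
  moreover have "filter (\<lambda>\<rho>. length \<rho> \<ge> 2) (flat ps' m') = \<rho>s'"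
    unfolding d(4) by (rule filter_flat) (use d(3) in \<open>auto simp: rigid_decomp_def\<close>)
  ultimately show "\<rho>s = \<rho>s'" by simp
qed

lemma red_eqI:
  assumes "\<pi> \<in> perms" "rigid_decomp \<pi> ps m"
  shows "red \<pi> = dsum_list (map snd ps)"
proof -
  have "rigid_components \<pi> = map snd ps"
    unfolding rigid_components_def
    by (rule the1_equality[OF rigid_components_ex1[OF assms(1)]]) (use assms(2) in blast)
  then show ?thesis by (simp add: red_def)
qed

end

theory Submission
  imports Defs "HOL-Real_Asymp.Real_Asymp"
begin

text \<open>
  Every \<open>red x\<close> is involved in \<open>x\<close>, so passing to \<open>red ` X\<close> can only shrink the class; what needs
  an argument is that the growth rate does not drop. The articulation points of the elements of
  \<open>X\<close> are removed one at a time, so it suffices to compare a class avoiding \<open>\<alpha> \<oplus> 1 \<oplus> \<beta>\<close> with the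
  class avoiding \<open>\<alpha> \<oplus> \<beta>\<close> instead, where either \<open>\<alpha>\<close> is non-empty and does not end with its maximum
  or \<open>\<beta>\<close> is non-empty and does not start with its minimum. An articulation point next to a component
  of length at least 2 has this form, and as long as there is such a component all articulation
  points can be removed in a suitable order (\<open>growth_rate_strip_after\<close>, \<open>growth_rate_strip_before\<close>).
  If there is none, \<open>x\<close> is increasing, a 321-avoiding permutation avoiding \<open>x\<close> has bounded length,
  and both growth rates are 0.

  The comparison rests on a 2-colouring. Let \<open>\<pi>\<close> of length \<open>n\<close> avoid 321 and \<open>\<alpha> \<oplus> 1 \<oplus> \<beta>\<close>. Then the
  entries of \<open>\<pi>\<close> can be coloured so that no copy of \<open>\<alpha> \<oplus> \<beta>\<close> is monochromatic, and so that the colour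
  changes only \<open>O(\<surd>n)\<close> times when the entries are read by position, and also when they are read by
  value. The two colour classes, as patterns, belong to the smaller class, and \<open>\<pi>\<close> is recovered from
  them together with the set of positions and the set of values of one colour. There are only
  \<open>exp (O(\<surd>n log n))\<close> such pairs of sets, a subexponential number, so the larger class has no larger
  growth rate (\<open>growth_rate_le_of_splitting\<close>).

  The colouring is found in two steps, in the plot of \<open>\<pi>\<close>. First, there is a point \<open>(x0, y0)\<close> such that
  every copy of \<open>\<alpha> \<oplus> \<beta>\<close> has entries both in the north-west and in the south-east quadrant of
  \<open>(x0, y0)\<close> (\<open>corner_exists\<close>): for \<open>x0\<close> and \<open>y0\<close> one takes the smallest position of the rightmost, and
  the smallest value of the topmost, entry of the \<open>\<alpha>\<close>-part of a copy. Second, for any point, the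
  north-west quadrant can be coloured with one colour and the south-east quadrant with the other, and
  the colouring can be extended to the remaining two quadrants with few changes of colour
  (\<open>quadrant_coloring\<close>). The extension is forced along two spirals that run down and to the
  left (or up and to the right); 321-avoidance keeps the two spirals disjoint. Each turn of a
  spiral costs one change of colour. The successive turns use disjoint sets of entries, so after at
  most \<open>\<surd>n\<close> of them there is a turn with at most \<open>\<surd>n\<close> entries, at which the spiral can be cut off.
\<close>

section \<open>Colourings of 321-avoiding point sets\<close>

text \<open>Points are elements of an arbitrary type with integer coordinates \<open>x\<close> and \<open>y\<close>, so that reflections
  of the plane become changes of the coordinate functions.\<close>

definition no321 :: "('a \<Rightarrow> int) \<Rightarrow> ('a \<Rightarrow> int) \<Rightarrow> 'a set \<Rightarrow> bool" where
  "no321 x y S \<longleftrightarrow> (\<forall>p\<in>S. \<forall>q\<in>S. \<forall>r\<in>S. x p < x q \<longrightarrow> x q < x r \<longrightarrow> y q < y p \<longrightarrow> \<not> y r < y q)"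

text \<open>The colouring \<open>c\<close> is constant on the blocks into which the thresholds \<open>C\<close> divide \<open>T\<close> along the
  coordinate \<open>f\<close>; hence \<open>card C\<close> bounds the number of changes of colour. Recording thresholds
  instead of counting changes makes it trivial to combine colourings of different regions.\<close>

definition cut_by :: "int set \<Rightarrow> ('a \<Rightarrow> int) \<Rightarrow> 'a set \<Rightarrow> ('a \<Rightarrow> bool) \<Rightarrow> bool" where
  "cut_by C f T c \<longleftrightarrow> (\<forall>p\<in>T. \<forall>q\<in>T. (\<forall>t\<in>C. t \<le> f p \<longleftrightarrow> t \<le> f q) \<longrightarrow> c p = c q)"

lemma no321_subset: "no321 x y S \<Longrightarrow> T \<subseteq> S \<Longrightarrow> no321 x y T"
  unfolding no321_def by blast

lemma no321D:
  assumes "no321 x y S" "p \<in> S" "q \<in> S" "r \<in> S" "x p < x q" "x q < x r" "y q < y p" "y r < y q"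
  shows False
  using assms unfolding no321_def by blast

lemma cut_byD: "cut_by C f T c \<Longrightarrow> p \<in> T \<Longrightarrow> q \<in> T \<Longrightarrow> (\<And>t. t \<in> C \<Longrightarrow> t \<le> f p \<longleftrightarrow> t \<le> f q) \<Longrightarrow> c p = c q"
  unfolding cut_by_def by blast

lemma inj_on_neq: "inj_on f S \<Longrightarrow> p \<in> S \<Longrightarrow> q \<in> S \<Longrightarrow> p \<noteq> q \<Longrightarrow> f p \<noteq> f q"
  by (auto dest: inj_onD)

lemma arg_min_on_set:
  fixes f :: "'a \<Rightarrow> int"
  assumes "finite A" "A \<noteq> {}"
  obtains a where "a \<in> A" "\<And>b. b \<in> A \<Longrightarrow> f a \<le> f b"
proof -
  have "Min (f ` A) \<in> f ` A" using assms by simp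
  then obtain a where "a \<in> A" "Min (f ` A) = f a" by blast
  then show ?thesis using that[of a] assms Min_le[of "f ` A"] by simp
qed

lemma arg_max_on_set:
  fixes f :: "'a \<Rightarrow> int"
  assumes "finite A" "A \<noteq> {}"
  obtains a where "a \<in> A" "\<And>b. b \<in> A \<Longrightarrow> f b \<le> f a"
proof -
  have "Max (f ` A) \<in> f ` A" using assms by simp
  then obtain a where "a \<in> A" "Max (f ` A) = f a" by blast
  then show ?thesis using that[of a] assms Max_ge[of "f ` A"] by simp
qed

text \<open>The set \<open>W\<close> lies below \<open>A\<close> and to the left of \<open>B\<close>, as the south-west quadrant lies with respect to the
  north-west and the south-east one. The points of \<open>W\<close> to the right of the leftmost point of \<open>A\<close> are
  interleaved with \<open>A\<close> by position, so they get the colour of \<open>A\<close>; those above the lowest point of \<open>B\<close>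
  are interleaved with \<open>B\<close> by value and get the colour of \<open>B\<close>. A point of both kinds would complete a
  decreasing triple. The rest of \<open>W\<close> lies to these two new sets as \<open>W\<close> lies to \<open>B\<close> and \<open>A\<close>, with the
  colours exchanged, so the construction repeats. It stops when \<open>A\<close> has at most \<open>s\<close> points: then all
  of \<open>W\<close> takes the colour of \<open>B\<close>, and \<open>A\<close> is isolated by \<open>2 * s\<close> thresholds. As every
  round uses up more than \<open>s\<close> points, there are at most \<open>k\<close> rounds.\<close>

lemma corner_coloring:
  fixes x y :: "'a \<Rightarrow> int"
  assumes "finite (A \<union> B \<union> W)" "inj_on x (A \<union> B \<union> W)" "inj_on y (A \<union> B \<union> W)"
    and "no321 x y (A \<union> B \<union> W)"
    and "\<And>a w. a \<in> A \<Longrightarrow> w \<in> W \<Longrightarrow> y w < y a"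
    and "\<And>b w. b \<in> B \<Longrightarrow> w \<in> W \<Longrightarrow> x w < x b"
    and "\<And>a b. a \<in> A \<Longrightarrow> b \<in> B \<Longrightarrow> x a < x b \<and> y b < y a"
    and "card (A \<union> W) \<le> k * s"
  shows "\<exists>c C D. (\<forall>a\<in>A. c a = v) \<and> (\<forall>b\<in>B. c b = (\<not> v)) \<and>
    finite C \<and> finite D \<and> card C \<le> k + 2 * s \<and> card D \<le> k + 2 * s \<and>
    cut_by C x (A \<union> W) c \<and> cut_by D y (B \<union> W) c"
  using assms
proof (induction k arbitrary: A B W v)
  case 0
  then have "A = {}" "W = {}" by auto
  then have "(\<forall>a\<in>A. (\<lambda>_. \<not> v) a = v) \<and> (\<forall>b\<in>B. (\<lambda>_. \<not> v) b = (\<not> v)) \<and>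
      finite ({} :: int set) \<and> finite ({} :: int set) \<and> card ({} :: int set) \<le> 0 + 2 * s \<and> card ({} :: int set) \<le> 0 + 2 * s \<and>
      cut_by ({} :: int set) x (A \<union> W) (\<lambda>_. \<not> v) \<and> cut_by ({} :: int set) y (B \<union> W) (\<lambda>_. \<not> v)"
    by (auto simp: cut_by_def)
  then show ?case by (intro exI)
next
  case (Suc k)
  have fin: "finite A" "finite B" "finite W" using Suc.prems(1) by auto
  have AW: "A \<inter> W = {}" "A \<inter> B = {}" "B \<inter> W = {}"
    using Suc.prems(5-7) by (force)+
  consider "card A \<le> s" | "B = {}" | "s < card A" "B \<noteq> {}" by linarith
  then show ?case
  proof cases
    case 1
    \<comment> \<open>Thresholds directly before and after each point of A.\<close>
    define C where "C = x ` A \<union> (\<lambda>a. x a + 1) ` A"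
    define c where "c = (\<lambda>p. if p \<in> A then v else \<not> v)"
    have "card C \<le> card A + card A" unfolding C_def
      by (meson add_mono card_Un_le card_image_le fin(1) order_trans)
    then have card: "card C \<le> Suc k + 2 * s" using 1 by simp
    have same: "p = q" if pq: "p \<in> A" "q \<in> A \<union> W" "\<forall>t\<in>C. t \<le> x p \<longleftrightarrow> t \<le> x q" for p q
    proof -
      have "x p \<in> C" "x p + 1 \<in> C" using pq(1) by (auto simp: C_def)
      then have "x p \<le> x q" "\<not> x p + 1 \<le> x q" using pq(3) by force+
      then have "x p = x q" by simp
      then show ?thesis using pq Suc.prems(2) by (auto dest: inj_onD)
    qed
    have "cut_by C x (A \<union> W) c" unfolding cut_by_def
    proof (intro ballI impI)
      fix p q assume pq: "p \<in> A \<union> W" "q \<in> A \<union> W" "\<forall>t\<in>C. (t \<le> x p) = (t \<le> x q)"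
      show "c p = c q"
      proof (cases "p \<in> A \<or> q \<in> A")
        case True then show ?thesis using same[of p q] same[of q p] pq by auto
      qed (simp add: c_def)
    qed
    moreover have "cut_by {} y (B \<union> W) c" using AW by (auto simp: cut_by_def c_def)
    moreover have "finite C" using fin by (simp add: C_def)
    moreover have "\<forall>a\<in>A. c a = v" "\<forall>b\<in>B. c b = (\<not> v)" using AW by (auto simp: c_def)
    ultimately have "(\<forall>a\<in>A. c a = v) \<and> (\<forall>b\<in>B. c b = (\<not> v)) \<and>
      finite C \<and> finite ({} :: int set) \<and> card C \<le> Suc k + 2 * s \<and> card ({} :: int set) \<le> Suc k + 2 * s \<and>
      cut_by C x (A \<union> W) c \<and> cut_by ({} :: int set) y (B \<union> W) c"
      using card by simp
    then show ?thesis by (intro exI)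
  next
    case 2
    then have "(\<forall>a\<in>A. (\<lambda>_. v) a = v) \<and> (\<forall>b\<in>B. (\<lambda>_. v) b = (\<not> v)) \<and>
      finite ({} :: int set) \<and> finite ({} :: int set) \<and> card ({} :: int set) \<le> Suc k + 2 * s \<and> card ({} :: int set) \<le> Suc k + 2 * s \<and>
      cut_by ({} :: int set) x (A \<union> W) (\<lambda>_. v) \<and> cut_by ({} :: int set) y (B \<union> W) (\<lambda>_. v)"
      by (auto simp: cut_by_def)
    then show ?thesis by (intro exI)
  next
    case 3
    then have "A \<noteq> {}" by auto
    obtain a0 where a0: "a0 \<in> A" "\<And>a. a \<in> A \<Longrightarrow> x a0 \<le> x a"
      using arg_min_on_set[OF fin(1) \<open>A \<noteq> {}\<close>, of x] by blast
    obtain b0 where b0: "b0 \<in> B" "\<And>b. b \<in> B \<Longrightarrow> y b0 \<le> y b"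
      using arg_min_on_set[OF fin(2) 3(2), of y] by blast
    \<comment> \<open>A' lies above the rest W' and B' to the right of it; they take over the parts of A and B.\<close>
    define A' where "A' = {w \<in> W. y b0 < y w}"
    define B' where "B' = {w \<in> W. x a0 < x w}"
    define W' where "W' = {w \<in> W. y w < y b0 \<and> x w < x a0}"
    have sub: "A' \<union> B' \<union> W' \<subseteq> W" by (auto simp: A'_def B'_def W'_def)
    have neq: "x w \<noteq> x a0" "y w \<noteq> y b0" if "w \<in> W" for w
      using that a0(1) b0(1) Suc.prems(2,3) AW by (auto dest!: inj_onD)
    have W: "W \<subseteq> A' \<union> B' \<union> W'" using neq by (force simp: A'_def B'_def W'_def)
    \<comment> \<open>A point in both sets would sit between a0 and b0 in a decreasing triple.\<close>
    have disj: "p \<notin> B'" if "p \<in> A'" for p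
    proof
      assume "p \<in> B'"
      then show False
        using that no321D[OF Suc.prems(4), of a0 p b0] a0(1) b0(1) Suc.prems(5)[OF a0(1), of p]
          Suc.prems(6)[OF b0(1), of p]
        by (auto simp: A'_def B'_def)
    qed
    have "card (A' \<union> W') \<le> card W" using sub fin by (intro card_mono) auto
    moreover have "card (A \<union> W) = card A + card W" using fin AW by (intro card_Un_disjoint) auto
    ultimately have "card (A' \<union> W') \<le> k * s" using Suc.prems(8) 3 by simp
    moreover have "x a < x b \<and> y b < y a" if "a \<in> A'" "b \<in> B'" for a b
      using that disj neq by (force simp: A'_def B'_def)
    moreover have "y w < y a" if "a \<in> A'" "w \<in> W'" for a w using that by (auto simp: A'_def W'_def)
    moreover have "x w < x b" if "b \<in> B'" "w \<in> W'" for b w using that by (auto simp: B'_def W'_def)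
    moreover have "finite (A' \<union> B' \<union> W')" using sub fin finite_subset by blast
    moreover have "inj_on x (A' \<union> B' \<union> W')" "inj_on y (A' \<union> B' \<union> W')"
      using Suc.prems(2,3) sub by (meson inj_on_subset le_supI2)+
    moreover have "no321 x y (A' \<union> B' \<union> W')"
      using Suc.prems(4) sub by (meson no321_subset le_supI2)
    ultimately obtain c C D where c: "\<forall>a\<in>A'. c a = (\<not> v)" "\<forall>b\<in>B'. c b = (\<not> \<not> v)"
      "finite C" "finite D" "card C \<le> k + 2 * s" "card D \<le> k + 2 * s"
      "cut_by C x (A' \<union> W') c" "cut_by D y (B' \<union> W') c"
      using Suc.IH[of A' B' W' "\<not> v"] by blast
    define c' where "c' = (\<lambda>p. if p \<in> A then v else if p \<in> B then \<not> v else c p)"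
    have cW: "c' p = c p" if "p \<in> W" for p using that AW by (auto simp: c'_def)
    \<comment> \<open>To the right of a0 only A and B' occur, and both have the colour v.\<close>
    have hi_x: "c' p = v" if "p \<in> A \<union> W" "x a0 \<le> x p" for p
    proof (cases "p \<in> A")
      case False
      then have "p \<in> B'" using that neq[of p] by (auto simp: B'_def)
      then show ?thesis using c(2) cW[of p] False that by auto
    qed (simp add: c'_def)
    have hi_y: "c' p = (\<not> v)" if "p \<in> B \<union> W" "y b0 \<le> y p" for p
    proof (cases "p \<in> B")
      case False
      then have "p \<in> A'" using that neq[of p] by (auto simp: A'_def)
      then show ?thesis using c(1) cW[of p] False that by auto
    next
      case True then show ?thesis using AW by (auto simp: c'_def)
    qed
    have "cut_by (insert (x a0) C) x (A \<union> W) c'" unfolding cut_by_def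
    proof (intro ballI impI)
      fix p q assume pq: "p \<in> A \<union> W" "q \<in> A \<union> W" "\<forall>t\<in>insert (x a0) C. (t \<le> x p) = (t \<le> x q)"
      show "c' p = c' q"
      proof (cases "x a0 \<le> x p")
        case True
        then show ?thesis using pq hi_x[of p] hi_x[of q] by auto
      next
        case False
        then have "x p < x a0" "x q < x a0" using pq(3) by auto
        then have "p \<in> W" "q \<in> W" "p \<notin> B'" "q \<notin> B'" using pq a0 by (force simp: B'_def)+
        then have "p \<in> A' \<union> W'" "q \<in> A' \<union> W'" using W by blast+
        then have "c p = c q" using pq(3) cut_byD[OF c(7)] by blast
        then show ?thesis using cW \<open>p \<in> W\<close> \<open>q \<in> W\<close> by simp
      qed
    qed
    moreover have "cut_by (insert (y b0) D) y (B \<union> W) c'" unfolding cut_by_def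
    proof (intro ballI impI)
      fix p q assume pq: "p \<in> B \<union> W" "q \<in> B \<union> W" "\<forall>t\<in>insert (y b0) D. (t \<le> y p) = (t \<le> y q)"
      show "c' p = c' q"
      proof (cases "y b0 \<le> y p")
        case True
        then show ?thesis using pq hi_y[of p] hi_y[of q] by auto
      next
        case False
        then have "y p < y b0" "y q < y b0" using pq(3) by auto
        then have "p \<in> W" "q \<in> W" "p \<notin> A'" "q \<notin> A'" using pq b0 by (force simp: A'_def)+
        then have "p \<in> B' \<union> W'" "q \<in> B' \<union> W'" using W by blast+
        then have "c p = c q" using pq(3) cut_byD[OF c(8)] by blast
        then show ?thesis using cW \<open>p \<in> W\<close> \<open>q \<in> W\<close> by simp
      qed
    qed
    moreover have "card (insert (x a0) C) \<le> Suc k + 2 * s" "card (insert (y b0) D) \<le> Suc k + 2 * s"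
      using c(3-6) by (simp_all add: card_insert_if)
    moreover have "\<forall>a\<in>A. c' a = v" "\<forall>b\<in>B. c' b = (\<not> v)" using AW by (auto simp: c'_def)
    ultimately have "(\<forall>a\<in>A. c' a = v) \<and> (\<forall>b\<in>B. c' b = (\<not> v)) \<and>
      finite (insert (x a0) C) \<and> finite (insert (y b0) D) \<and> card (insert (x a0) C) \<le> Suc k + 2 * s \<and> card (insert (y b0) D) \<le> Suc k + 2 * s \<and>
      cut_by (insert (x a0) C) x (A \<union> W) c' \<and> cut_by (insert (y b0) D) y (B \<union> W) c'"
      using c(3,4) by simp
    then show ?thesis by (intro exI)
  qed
qed

lemma cut_by_uminus:
  assumes "cut_by C (\<lambda>p. - f p) T c"
  shows "cut_by ((\<lambda>t. 1 - t) ` C) f T c"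
  unfolding cut_by_def
proof (intro ballI impI)
  fix p q assume pq: "p \<in> T" "q \<in> T" "\<forall>t\<in>(\<lambda>t. 1 - t) ` C. (t \<le> f p) = (t \<le> f q)"
  have "(t \<le> - f p) = (t \<le> - f q)" if "t \<in> C" for t
  proof -
    have "(1 - t \<le> f p) = (1 - t \<le> f q)" using pq(3) that by blast
    then show ?thesis by linarith
  qed
  then show "c p = c q" using cut_byD[OF assms pq(1,2)] by blast
qed

text \<open>The south-west and the north-east quadrant do not share positions or values, so they can be coloured
  independently. The north-east one becomes a south-west one under rotation by a half turn,
  which exchanges the roles of the other two quadrants.\<close>

lemma quadrant_coloring:
  fixes x y :: "'a \<Rightarrow> int"
  assumes S: "finite S" "inj_on x S" "inj_on y S" "no321 x y S" "card S \<le> m * m"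
  shows "\<exists>c C D. finite C \<and> finite D \<and> card C \<le> 6 * m + 1 \<and> card D \<le> 6 * m + 1 \<and>
    cut_by C x S c \<and> cut_by D y S c \<and>
    (\<forall>p\<in>S. x p < x0 \<longrightarrow> y0 \<le> y p \<longrightarrow> c p) \<and> (\<forall>p\<in>S. x0 \<le> x p \<longrightarrow> y p < y0 \<longrightarrow> \<not> c p)"
proof -
  define NW where "NW = {p \<in> S. x p < x0 \<and> y0 \<le> y p}"
  define SE where "SE = {p \<in> S. x0 \<le> x p \<and> y p < y0}"
  define SW where "SW = {p \<in> S. x p < x0 \<and> y p < y0}"
  define NE where "NE = {p \<in> S. x0 \<le> x p \<and> y0 \<le> y p}"
  note quad = NW_def SE_def SW_def NE_def
  have sub: "NW \<union> SE \<union> SW \<subseteq> S" "SE \<union> NW \<union> NE \<subseteq> S" by (auto simp: quad)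
  have bound: "card T \<le> m * m" if "T \<subseteq> S" for T
    using card_mono[OF S(1) that] S(5) by simp
  have "\<exists>c C D. (\<forall>a\<in>NW. c a = True) \<and> (\<forall>b\<in>SE. c b = (\<not> True)) \<and>
    finite C \<and> finite D \<and> card C \<le> m + 2 * m \<and> card D \<le> m + 2 * m \<and>
    cut_by C x (NW \<union> SW) c \<and> cut_by D y (SE \<union> SW) c"
    by (rule corner_coloring)
       (use S sub in \<open>auto intro!: bound intro: finite_subset inj_on_subset no321_subset simp: quad\<close>)
  then obtain c C D where c: "\<forall>a\<in>NW. c a" "\<forall>b\<in>SE. \<not> c b" "finite C" "finite D"
    "card C \<le> m + 2 * m" "card D \<le> m + 2 * m" "cut_by C x (NW \<union> SW) c" "cut_by D y (SE \<union> SW) c"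
    by auto
  have neg: "no321 (\<lambda>p. - x p) (\<lambda>p. - y p) S" "inj_on (\<lambda>p. - x p) S" "inj_on (\<lambda>p. - y p) S"
    using S(2-4) by (auto simp: no321_def inj_on_def)
  have "\<exists>c C D. (\<forall>a\<in>SE. c a = False) \<and> (\<forall>b\<in>NW. c b = (\<not> False)) \<and>
    finite C \<and> finite D \<and> card C \<le> m + 2 * m \<and> card D \<le> m + 2 * m \<and>
    cut_by C (\<lambda>p. - x p) (SE \<union> NE) c \<and> cut_by D (\<lambda>p. - y p) (NW \<union> NE) c"
    by (rule corner_coloring)
       (use S neg sub in \<open>auto intro!: bound intro: finite_subset inj_on_subset no321_subset simp: quad\<close>)
  then obtain c' C' D' where c': "\<forall>a\<in>SE. \<not> c' a" "\<forall>b\<in>NW. c' b" "finite C'" "finite D'"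
    "card C' \<le> m + 2 * m" "card D' \<le> m + 2 * m"
    "cut_by C' (\<lambda>p. - x p) (SE \<union> NE) c'" "cut_by D' (\<lambda>p. - y p) (NW \<union> NE) c'"
    by auto
  note up = cut_by_uminus[OF c'(7)] cut_by_uminus[OF c'(8)]
  define d where "d = (\<lambda>p. if p \<in> SW then c p else c' p)"
  define CC where "CC = insert x0 (C \<union> (\<lambda>t. 1 - t) ` C')"
  define DD where "DD = insert y0 (D \<union> (\<lambda>t. 1 - t) ` D')"
  have d1: "d p = c p" if "p \<in> NW \<union> SE \<union> SW" for p using that c c' by (auto simp: d_def)
  have d2: "d p = c' p" if "p \<in> NW \<union> SE \<union> NE" for p using that by (auto simp: d_def quad)
  have "cut_by CC x S d" unfolding cut_by_def
  proof (intro ballI impI)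
    fix p q assume pq: "p \<in> S" "q \<in> S" "\<forall>t\<in>CC. (t \<le> x p) = (t \<le> x q)"
    then have e: "x0 \<le> x p \<longleftrightarrow> x0 \<le> x q" by (simp add: CC_def)
    show "d p = d q"
    proof (cases "x0 \<le> x p")
      case True
      then have "p \<in> SE \<union> NE" "q \<in> SE \<union> NE" using e pq by (auto simp: quad)
      moreover from this have "c' p = c' q"
        using cut_byD[OF up(1)] pq(3) by (metis CC_def UnCI insertCI)
      ultimately show ?thesis using d2[of p] d2[of q] by auto
    next
      case False
      then have "p \<in> NW \<union> SW" "q \<in> NW \<union> SW" using e pq by (auto simp: quad)
      moreover from this have "c p = c q"
        using cut_byD[OF c(7)] pq(3) by (metis CC_def UnCI insertCI)
      ultimately show ?thesis using d1[of p] d1[of q] by auto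
    qed
  qed
  moreover have "cut_by DD y S d" unfolding cut_by_def
  proof (intro ballI impI)
    fix p q assume pq: "p \<in> S" "q \<in> S" "\<forall>t\<in>DD. (t \<le> y p) = (t \<le> y q)"
    then have e: "y0 \<le> y p \<longleftrightarrow> y0 \<le> y q" by (simp add: DD_def)
    show "d p = d q"
    proof (cases "y0 \<le> y p")
      case True
      then have "p \<in> NW \<union> NE" "q \<in> NW \<union> NE" using e pq by (auto simp: quad)
      moreover from this have "c' p = c' q"
        using cut_byD[OF up(2)] pq(3) by (metis DD_def UnCI insertCI)
      ultimately show ?thesis using d2[of p] d2[of q] by auto
    next
      case False
      then have "p \<in> SE \<union> SW" "q \<in> SE \<union> SW" using e pq by (auto simp: quad)
      moreover from this have "c p = c q"
        using cut_byD[OF c(8)] pq(3) by (metis DD_def UnCI insertCI)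
      ultimately show ?thesis using d1[of p] d1[of q] by auto
    qed
  qed
  moreover have "card (insert t (E \<union> (\<lambda>t. 1 - t) ` E')) \<le> 6 * m + 1"
    if "card E \<le> m + 2 * m" "card E' \<le> m + 2 * m" "finite E" "finite E'" for t :: int and E E'
    using that card_Un_le[of E "(\<lambda>t. 1 - t) ` E'"] card_image_le[of E' "\<lambda>t. 1 - t"]
    by (simp add: card_insert_if)
  then have "card CC \<le> 6 * m + 1" "card DD \<le> 6 * m + 1"
    unfolding CC_def DD_def using c c' by blast+
  moreover have "\<forall>p\<in>S. x p < x0 \<longrightarrow> y0 \<le> y p \<longrightarrow> d p" "\<forall>p\<in>S. x0 \<le> x p \<longrightarrow> y p < y0 \<longrightarrow> \<not> d p"
    using c'(1,2) d2 by (auto simp: NW_def SE_def)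
  moreover have "finite CC" "finite DD" using c c' by (auto simp: CC_def DD_def)
  ultimately show ?thesis by blast
qed

section \<open>A corner that separates every copy\<close>

text \<open>For \<open>i = 1, 2\<close> the topmost point of \<open>A\<^sub>i\<close> is \<open>m\<^sub>i\<close> and the rightmost one is \<open>r\<^sub>i\<close>. If \<open>m3\<close> were not to the left
  of \<open>r1\<close>, then \<open>m1\<close>, \<open>m3\<close>, \<open>r2\<close> would be a decreasing triple: \<open>m3\<close> is below \<open>m1\<close> as it does not
  dominate \<open>A1\<close>, and to the left of \<open>r2\<close> as it does not dominate \<open>A2\<close>. Coincidences among these points
  are excluded by \<open>m1 \<noteq> r1\<close> and \<open>m2 \<noteq> r2\<close>.\<close>

lemma corner_hits_NW:
  fixes x y :: "'a \<Rightarrow> int"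
  assumes S: "inj_on x S" "inj_on y S" "no321 x y S"
    and mem: "A1 \<subseteq> S" "A2 \<subseteq> S" "A3 \<subseteq> S"
    and A1: "m1 \<in> A1" "r1 \<in> A1" "\<And>p. p \<in> A1 \<Longrightarrow> y p \<le> y m1" "\<And>p. p \<in> A1 \<Longrightarrow> x p \<le> x r1" "m1 \<noteq> r1"
    and A2: "m2 \<in> A2" "r2 \<in> A2" "\<And>p. p \<in> A2 \<Longrightarrow> y p \<le> y m2" "\<And>p. p \<in> A2 \<Longrightarrow> x p \<le> x r2" "m2 \<noteq> r2"
    and m3: "m3 \<in> A3" "y m2 \<le> y m3"
    and dom: "\<not> (\<forall>q\<in>A1. x q < x m3 \<and> y q < y m3)" "\<not> (\<forall>q\<in>A2. x q < x m3 \<and> y q < y m3)"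
  shows "x m3 < x r1"
proof (rule ccontr)
  assume "\<not> x m3 < x r1"
  then have le: "x r1 \<le> x m3" by simp
  have in_S: "m1 \<in> S" "r1 \<in> S" "m2 \<in> S" "r2 \<in> S" "m3 \<in> S" using A1 A2 m3 mem by auto
  have m1: "x m1 < x r1" "y r1 < y m1"
    using A1(3)[OF A1(2)] A1(4)[OF A1(1)] A1(5) inj_on_neq[OF S(1) in_S(1,2)]
      inj_on_neq[OF S(2) in_S(1,2)] by auto
  have r2: "x m2 < x r2" "y r2 < y m2"
    using A2(3)[OF A2(2)] A2(4)[OF A2(1)] A2(5) inj_on_neq[OF S(1) in_S(3,4)]
      inj_on_neq[OF S(2) in_S(3,4)] by auto
  have "y m3 < y m1"
  proof (rule ccontr)
    assume n: "\<not> y m3 < y m1"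
    have "m3 \<noteq> m1" "m3 \<noteq> r1" using le m1 n by auto
    then have "y m3 \<noteq> y m1" "x m3 \<noteq> x r1"
      using inj_on_neq[OF S(2) in_S(5,1)] inj_on_neq[OF S(1) in_S(5,2)] by auto
    then have "y m1 < y m3" "x r1 < x m3" using n le by auto
    then show False using dom(1) A1(3,4) by (meson order_le_less_trans)
  qed
  moreover have "x m3 < x r2"
  proof (rule ccontr)
    assume n: "\<not> x m3 < x r2"
    have "m3 \<noteq> m2" "m3 \<noteq> r2" using m3 r2 n by auto
    then have "y m3 \<noteq> y m2" "x m3 \<noteq> x r2"
      using inj_on_neq[OF S(2) in_S(5,3)] inj_on_neq[OF S(1) in_S(5,4)] by auto
    then have "y m2 < y m3" "x r2 < x m3" using n m3 by auto
    then show False using dom(2) A2(3,4) by (meson order_le_less_trans)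
  qed
  ultimately show False
    using no321D[OF S(3) in_S(1,5,4)] m1 r2 le m3 by auto
qed

text \<open>Think of \<open>F\<close> as the \<open>\<alpha>\<close>-parts of the copies of \<open>\<alpha> \<oplus> \<beta>\<close>. The two coordinates of the corner
  are minimised separately, and one member of \<open>F\<close> need not attain both. The statement about the
  south-east quadrant is the one about the north-west quadrant with the coordinates exchanged.\<close>

lemma corner_exists:
  fixes x y :: "'a \<Rightarrow> int"
  assumes S: "finite S" "inj_on x S" "inj_on y S" "no321 x y S"
    and F: "\<And>A. A \<in> F \<Longrightarrow> A \<subseteq> S \<and> A \<noteq> {}"
    and no_max: "\<And>A p. A \<in> F \<Longrightarrow> p \<in> A \<Longrightarrow> \<exists>q\<in>A. x p < x q \<or> y p < y q"
    and dom: "\<And>A A' p. A \<in> F \<Longrightarrow> A' \<in> F \<Longrightarrow> p \<in> A' \<Longrightarrow> \<not> (\<forall>q\<in>A. x q < x p \<and> y q < y p)"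
  shows "\<exists>x0 y0. \<forall>A\<in>F. (\<exists>p\<in>A. x p < x0 \<and> y0 \<le> y p) \<and> (\<exists>p\<in>A. x0 \<le> x p \<and> y p < y0)"
proof (cases "F = {}")
  case True
  then show ?thesis by blast
next
  case False
  have "F \<subseteq> Pow S" using F by blast
  then have finF: "finite F" by (rule finite_subset) (simp add: S(1))
  have finA: "finite A" if "A \<in> F" for A using F[OF that] S(1) by (auto intro: finite_subset)
  have "\<exists>r\<in>A. \<forall>p\<in>A. x p \<le> x r" if "A \<in> F" for A
    using arg_max_on_set[OF finA[OF that], of x] F[OF that] by metis
  then obtain r where r: "\<And>A. A \<in> F \<Longrightarrow> r A \<in> A" "\<And>A p. A \<in> F \<Longrightarrow> p \<in> A \<Longrightarrow> x p \<le> x (r A)"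
    by metis
  have "\<exists>m\<in>A. \<forall>p\<in>A. y p \<le> y m" if "A \<in> F" for A
    using arg_max_on_set[OF finA[OF that], of y] F[OF that] by metis
  then obtain m where m: "\<And>A. A \<in> F \<Longrightarrow> m A \<in> A" "\<And>A p. A \<in> F \<Longrightarrow> p \<in> A \<Longrightarrow> y p \<le> y (m A)"
    by metis
  have mr: "m A \<noteq> r A" if "A \<in> F" for A
    using no_max[OF that r(1)[OF that]] r(2)[OF that] m(2)[OF that] by (metis leD)
  obtain A1 where A1: "A1 \<in> F" "\<And>A. A \<in> F \<Longrightarrow> x (r A1) \<le> x (r A)"
    using arg_min_on_set[OF finF False, of "\<lambda>A. x (r A)"] by blast
  obtain A2 where A2: "A2 \<in> F" "\<And>A. A \<in> F \<Longrightarrow> y (m A2) \<le> y (m A)"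
    using arg_min_on_set[OF finF False, of "\<lambda>A. y (m A)"] by blast
  \<comment> \<open>Exchanging the coordinates reverses a decreasing triple.\<close>
  have S': "no321 y x S" using S(4) unfolding no321_def by blast
  have hit: "x (m A) < x (r A1) \<and> y (r A) < y (m A2)" if A: "A \<in> F" for A
  proof
    show "x (m A) < x (r A1)"
      by (rule corner_hits_NW[OF S(2-4), of A1 A2 A "m A1" "r A1" "m A2" "r A2" "m A"])
         (use A1 A2 A F r m mr dom in auto)
    show "y (r A) < y (m A2)"
      by (rule corner_hits_NW[OF S(3,2) S', of A2 A1 A "r A2" "m A2" "r A1" "m A1" "r A"])
         (use A1 A2 A F r m mr[symmetric] dom[OF _ A r(1)[OF A]] in \<open>auto simp: conj_commute\<close>)
  qed
  have "(\<exists>p\<in>A. x p < x (r A1) \<and> y (m A2) \<le> y p) \<and> (\<exists>p\<in>A. x (r A1) \<le> x p \<and> y p < y (m A2))"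
    if A: "A \<in> F" for A
    using hit[OF A] A1(2)[OF A] A2(2)[OF A] r(1)[OF A] m(1)[OF A] by blast
  then show ?thesis by blast
qed

lemma splitting_coloring:
  fixes x y :: "'a \<Rightarrow> int"
  assumes S: "finite S" "inj_on x S" "inj_on y S" "no321 x y S" "card S \<le> m * m"
    and F: "\<And>A. A \<in> F \<Longrightarrow> A \<subseteq> S \<and> A \<noteq> {}"
    and no_max: "\<And>A p. A \<in> F \<Longrightarrow> p \<in> A \<Longrightarrow> \<exists>q\<in>A. x p < x q \<or> y p < y q"
    and dom: "\<And>A A' p. A \<in> F \<Longrightarrow> A' \<in> F \<Longrightarrow> p \<in> A' \<Longrightarrow> \<not> (\<forall>q\<in>A. x q < x p \<and> y q < y p)"
  shows "\<exists>c C D. finite C \<and> finite D \<and> card C \<le> 6 * m + 1 \<and> card D \<le> 6 * m + 1 \<and>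
    cut_by C x S c \<and> cut_by D y S c \<and> (\<forall>A\<in>F. (\<exists>p\<in>A. c p) \<and> (\<exists>p\<in>A. \<not> c p))"
proof -
  have "\<exists>x0 y0. \<forall>A\<in>F. (\<exists>p\<in>A. x p < x0 \<and> y0 \<le> y p) \<and> (\<exists>p\<in>A. x0 \<le> x p \<and> y p < y0)"
    by (rule corner_exists[OF S(1-4)]) (assumption | rule F no_max dom)+
  then obtain x0 y0 where *:
    "\<forall>A\<in>F. (\<exists>p\<in>A. x p < x0 \<and> y0 \<le> y p) \<and> (\<exists>p\<in>A. x0 \<le> x p \<and> y p < y0)"
    by blast
  obtain c C D where c: "finite C" "finite D" "card C \<le> 6 * m + 1" "card D \<le> 6 * m + 1"
    "cut_by C x S c" "cut_by D y S c"
    "\<forall>p\<in>S. x p < x0 \<longrightarrow> y0 \<le> y p \<longrightarrow> c p" "\<forall>p\<in>S. x0 \<le> x p \<longrightarrow> y p < y0 \<longrightarrow> \<not> c p"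
    using quadrant_coloring[OF S, of x0 y0] by blast
  have "(\<exists>p\<in>A. c p) \<and> (\<exists>p\<in>A. \<not> c p)" if A: "A \<in> F" for A
  proof -
    obtain p q where "p \<in> A" "x p < x0" "y0 \<le> y p" "q \<in> A" "x0 \<le> x q" "y q < y0"
      using * A by blast
    moreover have "p \<in> S" "q \<in> S" using \<open>p \<in> A\<close> \<open>q \<in> A\<close> F[OF A] by auto
    ultimately show ?thesis using c(7,8) by blast
  qed
  then have "\<forall>A\<in>F. (\<exists>p\<in>A. c p) \<and> (\<exists>p\<in>A. \<not> c p)" by blast
  with c(1-6) have "finite C \<and> finite D \<and> card C \<le> 6 * m + 1 \<and> card D \<le> 6 * m + 1 \<and>
    cut_by C x S c \<and> cut_by D y S c \<and> (\<forall>A\<in>F. (\<exists>p\<in>A. c p) \<and> (\<exists>p\<in>A. \<not> c p))"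
    by (intro conjI)
  then show ?thesis by (intro exI)
qed

text \<open>A half turn carries the \<open>\<beta>\<close>-parts of copies to sets that \<open>splitting_coloring\<close> applies to.\<close>

lemma splitting_coloring_dual:
  fixes x y :: "'a \<Rightarrow> int"
  assumes S: "finite S" "inj_on x S" "inj_on y S" "no321 x y S" "card S \<le> m * m"
    and F: "\<And>A. A \<in> F \<Longrightarrow> A \<subseteq> S \<and> A \<noteq> {}"
    and no_min: "\<And>A p. A \<in> F \<Longrightarrow> p \<in> A \<Longrightarrow> \<exists>q\<in>A. x q < x p \<or> y q < y p"
    and dom: "\<And>A A' p. A \<in> F \<Longrightarrow> A' \<in> F \<Longrightarrow> p \<in> A' \<Longrightarrow> \<not> (\<forall>q\<in>A. x p < x q \<and> y p < y q)"
  shows "\<exists>c C D. finite C \<and> finite D \<and> card C \<le> 6 * m + 1 \<and> card D \<le> 6 * m + 1 \<and>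
    cut_by C x S c \<and> cut_by D y S c \<and> (\<forall>A\<in>F. (\<exists>p\<in>A. c p) \<and> (\<exists>p\<in>A. \<not> c p))"
proof -
  have neg: "no321 (\<lambda>p. - x p) (\<lambda>p. - y p) S" "inj_on (\<lambda>p. - x p) S" "inj_on (\<lambda>p. - y p) S"
    using S(2-4) by (auto simp: no321_def inj_on_def)
  have "\<exists>c C D. finite C \<and> finite D \<and> card C \<le> 6 * m + 1 \<and> card D \<le> 6 * m + 1 \<and>
    cut_by C (\<lambda>p. - x p) S c \<and> cut_by D (\<lambda>p. - y p) S c \<and> (\<forall>A\<in>F. (\<exists>p\<in>A. c p) \<and> (\<exists>p\<in>A. \<not> c p))"
    by (rule splitting_coloring[OF S(1) neg(2,3,1) S(5)])
       (assumption | rule F | simp only: neg_less_iff_less, rule no_min dom)+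
  then obtain c C D where c: "finite C" "finite D" "card C \<le> 6 * m + 1" "card D \<le> 6 * m + 1"
    "cut_by C (\<lambda>p. - x p) S c" "cut_by D (\<lambda>p. - y p) S c" "\<forall>A\<in>F. (\<exists>p\<in>A. c p) \<and> (\<exists>p\<in>A. \<not> c p)"
    by blast
  have "card ((\<lambda>t. 1 - t) ` C) \<le> 6 * m + 1" "card ((\<lambda>t. 1 - t) ` D) \<le> 6 * m + 1"
    using card_image_le[OF c(1), of "\<lambda>t. 1 - t"] card_image_le[OF c(2), of "\<lambda>t. 1 - t"] c(3,4)
    by linarith+
  then have "finite ((\<lambda>t. 1 - t) ` C) \<and> finite ((\<lambda>t. 1 - t) ` D) \<and>
    card ((\<lambda>t. 1 - t) ` C) \<le> 6 * m + 1 \<and> card ((\<lambda>t. 1 - t) ` D) \<le> 6 * m + 1 \<and>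
    cut_by ((\<lambda>t. 1 - t) ` C) x S c \<and> cut_by ((\<lambda>t. 1 - t) ` D) y S c \<and>
    (\<forall>A\<in>F. (\<exists>p\<in>A. c p) \<and> (\<exists>p\<in>A. \<not> c p))"
    using finite_imageI[OF c(1)] finite_imageI[OF c(2)] cut_by_uminus[OF c(5)]
      cut_by_uminus[OF c(6)] c(7)
    by (intro conjI)
  then show ?thesis by (intro exI)
qed

section \<open>Involvement through index maps\<close>

text \<open>A copy of \<open>\<alpha>\<close> in \<open>\<pi>\<close> is represented by the map from the indices of \<open>\<alpha>\<close> to those of \<open>\<pi>\<close>, which,
  unlike a subsequence, can be composed, restricted to summands and glued.\<close>

definition emb :: "(nat \<Rightarrow> nat) \<Rightarrow> nat list \<Rightarrow> nat list \<Rightarrow> bool" where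
  "emb e \<alpha> \<pi> \<longleftrightarrow> (\<forall>i<length \<alpha>. e i < length \<pi>) \<and>
     (\<forall>i<length \<alpha>. \<forall>j<length \<alpha>. (i < j \<longrightarrow> e i < e j) \<and> (\<pi> ! e i < \<pi> ! e j \<longleftrightarrow> \<alpha> ! i < \<alpha> ! j))"

lemma subseq_imp_index_map:
  assumes "subseq xs ys"
  shows "\<exists>e. (\<forall>i<length xs. e i < length ys \<and> ys ! e i = xs ! i) \<and>
    (\<forall>i<length xs. \<forall>j<length xs. i < j \<longrightarrow> e i < (e j :: nat))"
  using assms
proof (induction rule: list_emb.induct)
  case (list_emb_Nil ys)
  then show ?case by simp
next
  case (list_emb_Cons xs ys y)
  then obtain e where "(\<forall>i<length xs. e i < length ys \<and> ys ! e i = xs ! i) \<and>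
    (\<forall>i<length xs. \<forall>j<length xs. i < j \<longrightarrow> e i < (e j :: nat))" by blast
  then show ?case by (intro exI[of _ "\<lambda>i. Suc (e i)"]) auto
next
  case (list_emb_Cons2 x y xs ys)
  then obtain e where "(\<forall>i<length xs. e i < length ys \<and> ys ! e i = xs ! i) \<and>
    (\<forall>i<length xs. \<forall>j<length xs. i < j \<longrightarrow> e i < (e j :: nat))" by blast
  with list_emb_Cons2(1) show ?case
    by (intro exI[of _ "case_nat 0 (\<lambda>i. Suc (e i))"]) (auto split: nat.split simp: less_Suc_eq_0_disj)
qed

lemma index_map_imp_subseq:
  assumes "\<And>i. i < length xs \<Longrightarrow> e i < length ys \<and> ys ! e i = xs ! i"
    and "\<And>i j. j < length xs \<Longrightarrow> i < j \<Longrightarrow> e i < (e j :: nat)"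
  shows "subseq xs ys"
  using assms
proof (induction ys arbitrary: xs e)
  case Nil
  then have "xs = []" by (cases xs) force+
  then show ?case by simp
next
  case (Cons y ys)
  show ?case
  proof (cases xs)
    case xs: (Cons x xs')
    have pos: "0 < e i" if "0 < i" "i < length xs" for i using Cons.prems(2)[of i 0] that by simp
    show ?thesis
    proof (cases "e 0")
      case 0
      have "subseq xs' ys"
      proof (rule Cons.IH[of xs' "\<lambda>i. e (Suc i) - 1"])
        fix i assume "i < length xs'"
        then show "e (Suc i) - 1 < length ys \<and> ys ! (e (Suc i) - 1) = xs' ! i"
          using Cons.prems(1)[of "Suc i"] pos[of "Suc i"] xs by (auto simp: nth_Cons')
      next
        fix i j assume "j < length xs'" "i < j"
        then show "e (Suc i) - 1 < e (Suc j) - 1"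
          using Cons.prems(2)[of "Suc j" "Suc i"] pos[of "Suc i"] xs by simp
      qed
      moreover have "x = y" using Cons.prems(1)[of 0] 0 xs by simp
      ultimately show ?thesis using xs by simp
    next
      case (Suc k)
      have pos': "0 < e i" if "i < length xs" for i using pos[of i] that Suc by (cases i) auto
      have "subseq xs ys"
      proof (rule Cons.IH[of xs "\<lambda>i. e i - 1"])
        fix i assume "i < length xs"
        then show "e i - 1 < length ys \<and> ys ! (e i - 1) = xs ! i"
          using Cons.prems(1)[of i] pos'[of i] by (auto simp: nth_Cons')
      next
        fix i j assume "j < length xs" "i < j"
        then show "e i - 1 < e j - 1"
          using Cons.prems(2)[of j i] pos'[of i] by simp
      qed
      then show ?thesis by (simp add: list_emb_Cons)
    qed
  qed simp
qed

lemma involved_iff_emb: "\<alpha> \<preceq>\<^sub>p \<pi> \<longleftrightarrow> (\<exists>e. emb e \<alpha> \<pi>)"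
proof
  assume "\<alpha> \<preceq>\<^sub>p \<pi>"
  then obtain \<tau> where \<tau>: "subseq \<tau> \<pi>" "order_isomorphic \<tau> \<alpha>" by (auto simp: involved_def)
  obtain e where "\<forall>i<length \<tau>. e i < length \<pi> \<and> \<pi> ! e i = \<tau> ! i"
    "\<forall>i<length \<tau>. \<forall>j<length \<tau>. i < j \<longrightarrow> e i < (e j :: nat)"
    using subseq_imp_index_map[OF \<tau>(1)] by blast
  with \<tau>(2) have "emb e \<alpha> \<pi>" by (simp add: emb_def order_isomorphic_def)
  then show "\<exists>e. emb e \<alpha> \<pi>" by blast
next
  assume "\<exists>e. emb e \<alpha> \<pi>"
  then obtain e where e: "emb e \<alpha> \<pi>" by blast
  define \<tau> where "\<tau> = map (\<lambda>i. \<pi> ! e i) [0..<length \<alpha>]"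
  have "subseq \<tau> \<pi>"
    by (rule index_map_imp_subseq[of _ e]) (use e in \<open>auto simp: \<tau>_def emb_def\<close>)
  moreover have "order_isomorphic \<tau> \<alpha>"
    using e by (auto simp: \<tau>_def emb_def order_isomorphic_def)
  ultimately show "\<alpha> \<preceq>\<^sub>p \<pi>" by (auto simp: involved_def)
qed

lemma emb_trans: "emb e \<alpha> \<beta> \<Longrightarrow> emb f \<beta> \<pi> \<Longrightarrow> emb (\<lambda>i. f (e i)) \<alpha> \<pi>"
  by (simp add: emb_def)

lemma involved_trans: "\<alpha> \<preceq>\<^sub>p \<beta> \<Longrightarrow> \<beta> \<preceq>\<^sub>p \<pi> \<Longrightarrow> \<alpha> \<preceq>\<^sub>p \<pi>"
  using emb_trans by (metis involved_iff_emb)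

lemma perms_nth: "\<alpha> \<in> perms \<Longrightarrow> i < length \<alpha> \<Longrightarrow> 0 < \<alpha> ! i \<and> \<alpha> ! i \<le> length \<alpha>"
  using nth_mem[of i \<alpha>] by (auto simp: perms_iff)

lemma dsum_nth:
  "i < length \<alpha> \<Longrightarrow> (\<alpha> \<oplus>\<^sub>p \<beta>) ! i = \<alpha> ! i"
  "j < length \<beta> \<Longrightarrow> (\<alpha> \<oplus>\<^sub>p \<beta>) ! (length \<alpha> + j) = length \<alpha> + \<beta> ! j"
  by (simp_all add: dsum_def nth_append)

lemma emb_dsumI:
  assumes "\<alpha> \<in> perms" "\<beta> \<in> perms" "emb e \<alpha> \<pi>" "emb f \<beta> \<pi>"
    and below: "\<And>i j. i < length \<alpha> \<Longrightarrow> j < length \<beta> \<Longrightarrow> e i < f j \<and> \<pi> ! e i < \<pi> ! f j"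
  shows "emb (\<lambda>i. if i < length \<alpha> then e i else f (i - length \<alpha>)) (\<alpha> \<oplus>\<^sub>p \<beta>) \<pi>"
proof -
  let ?g = "\<lambda>i. if i < length \<alpha> then e i else f (i - length \<alpha>)"
  have parts: "k < length \<alpha> \<or> (\<exists>k'. k = length \<alpha> + k' \<and> k' < length \<beta>)"
    if "k < length \<alpha> + length \<beta>" for k
    using that by presburger
  have pair: "(i < j \<longrightarrow> ?g i < ?g j) \<and> (\<pi> ! ?g i < \<pi> ! ?g j \<longleftrightarrow> (\<alpha> \<oplus>\<^sub>p \<beta>) ! i < (\<alpha> \<oplus>\<^sub>p \<beta>) ! j)"
    if ij: "i < length \<alpha> + length \<beta>" "j < length \<alpha> + length \<beta>" for i j
  proof -
    consider "i < length \<alpha>" "j < length \<alpha>" | j' where "i < length \<alpha>" "j = length \<alpha> + j'" "j' < length \<beta>"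
      | i' where "i = length \<alpha> + i'" "i' < length \<beta>" "j < length \<alpha>"
      | i' j' where "i = length \<alpha> + i'" "i' < length \<beta>" "j = length \<alpha> + j'" "j' < length \<beta>"
      using parts[OF ij(1)] parts[OF ij(2)] by blast
    then show ?thesis
    proof cases
      case 1 then show ?thesis using assms(3) by (simp add: emb_def dsum_nth)
    next
      case 2 then show ?thesis
        using below[of i j'] perms_nth[OF assms(1), of i] perms_nth[OF assms(2), of j']
        by (simp add: dsum_nth)
    next
      case 3 then show ?thesis
        using below[of j i'] perms_nth[OF assms(1), of j] perms_nth[OF assms(2), of i']
        by (simp add: dsum_nth)
    next
      case 4 then show ?thesis using assms(4) by (simp add: emb_def dsum_nth)
    qed
  qed
  have "?g i < length \<pi>" if "i < length \<alpha> + length \<beta>" for i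
    using that assms(3,4) by (auto simp: emb_def)
  with pair show ?thesis unfolding emb_def length_dsum by blast
qed

lemma emb_dsumD:
  assumes "\<alpha> \<in> perms" "\<beta> \<in> perms" "emb e (\<alpha> \<oplus>\<^sub>p \<beta>) \<pi>"
  shows "emb e \<alpha> \<pi>" "emb (\<lambda>j. e (length \<alpha> + j)) \<beta> \<pi>"
    and "\<And>i j. i < length \<alpha> \<Longrightarrow> j < length \<beta> \<Longrightarrow>
      e i < e (length \<alpha> + j) \<and> \<pi> ! e i < \<pi> ! e (length \<alpha> + j)"
proof -
  have len: "e i < length \<pi>" if "i < length \<alpha> + length \<beta>" for i
    using assms(3) that unfolding emb_def length_dsum by blast
  have rel: "(i < j \<longrightarrow> e i < e j) \<and> (\<pi> ! e i < \<pi> ! e j \<longleftrightarrow> (\<alpha> \<oplus>\<^sub>p \<beta>) ! i < (\<alpha> \<oplus>\<^sub>p \<beta>) ! j)"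
    if "i < length \<alpha> + length \<beta>" "j < length \<alpha> + length \<beta>" for i j
    using assms(3) that unfolding emb_def length_dsum by blast
  show "emb e \<alpha> \<pi>" unfolding emb_def using len rel by (auto simp: dsum_nth)
  show "emb (\<lambda>j. e (length \<alpha> + j)) \<beta> \<pi>" unfolding emb_def using len rel by (auto simp: dsum_nth)
  show "e i < e (length \<alpha> + j) \<and> \<pi> ! e i < \<pi> ! e (length \<alpha> + j)"
    if "i < length \<alpha>" "j < length \<beta>" for i j
    using rel[of i "length \<alpha> + j"] that perms_nth[OF assms(1), of i] perms_nth[OF assms(2), of j]
    by (simp add: dsum_nth)
qed

lemma dsum_involved_mono:
  assumes "\<alpha> \<in> perms" "\<beta> \<in> perms" "\<alpha>' \<in> perms" "\<beta>' \<in> perms" "\<alpha> \<preceq>\<^sub>p \<alpha>'" "\<beta> \<preceq>\<^sub>p \<beta>'"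
  shows "\<alpha> \<oplus>\<^sub>p \<beta> \<preceq>\<^sub>p \<alpha>' \<oplus>\<^sub>p \<beta>'"
proof -
  obtain e f where ef: "emb e \<alpha> \<alpha>'" "emb f \<beta> \<beta>'" using assms(5,6) by (auto simp: involved_iff_emb)
  have id: "emb (\<lambda>i. i) (\<alpha>' \<oplus>\<^sub>p \<beta>') (\<alpha>' \<oplus>\<^sub>p \<beta>')" by (simp add: emb_def)
  note d = emb_dsumD[OF assms(3,4) id]
  have "e i < length \<alpha>'" if "i < length \<alpha>" for i using ef that by (simp add: emb_def)
  moreover have "f j < length \<beta>'" if "j < length \<beta>" for j using ef that by (simp add: emb_def)
  ultimately have "\<exists>g. emb g (\<alpha> \<oplus>\<^sub>p \<beta>) (\<alpha>' \<oplus>\<^sub>p \<beta>')"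
    using emb_dsumI[OF assms(1,2) emb_trans[OF ef(1) d(1)] emb_trans[OF ef(2) d(2)]] d(3) by blast
  then show ?thesis by (simp add: involved_iff_emb)
qed

section \<open>Subpatterns at given positions\<close>

definition standardize :: "nat list \<Rightarrow> nat list" where
  "standardize xs = map (\<lambda>v. card {w \<in> set xs. w \<le> v}) xs"

definition piece :: "nat list \<Rightarrow> nat set \<Rightarrow> nat list" where
  "piece \<pi> I = standardize (map ((!) \<pi>) (sorted_list_of_set I))"

lemma rank_less_iff:
  fixes V :: "nat set"
  assumes "finite V" "v \<in> V" "w \<in> V"
  shows "card {u \<in> V. u \<le> v} < card {u \<in> V. u \<le> w} \<longleftrightarrow> v < w"
proof
  assume "v < w"
  then have "{u \<in> V. u \<le> v} \<subset> {u \<in> V. u \<le> w}" using assms by force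
  then show "card {u \<in> V. u \<le> v} < card {u \<in> V. u \<le> w}"
    using assms by (intro psubset_card_mono) auto
next
  assume l: "card {u \<in> V. u \<le> v} < card {u \<in> V. u \<le> w}"
  show "v < w"
  proof (rule ccontr)
    assume "\<not> v < w"
    then have "{u \<in> V. u \<le> w} \<subseteq> {u \<in> V. u \<le> v}" by auto
    then have "card {u \<in> V. u \<le> w} \<le> card {u \<in> V. u \<le> v}" using assms by (intro card_mono) auto
    with l show False by simp
  qed
qed

lemma rank_inj_on:
  fixes V :: "nat set"
  assumes "finite V"
  shows "inj_on (\<lambda>v. card {u \<in> V. u \<le> v}) V"
proof (rule inj_onI)
  fix v w assume "v \<in> V" "w \<in> V" "card {u \<in> V. u \<le> v} = card {u \<in> V. u \<le> w}"
  then show "v = w"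
    using rank_less_iff[OF assms, of v w] rank_less_iff[OF assms, of w v] by simp
qed

lemma standardize_perms:
  assumes "distinct xs"
  shows "standardize xs \<in> perms"
proof -
  let ?r = "\<lambda>v. card {w \<in> set xs. w \<le> v}"
  have inj: "inj_on ?r (set xs)" by (rule rank_inj_on) simp
  have "?r v \<in> {1..length xs}" if "v \<in> set xs" for v
  proof -
    have "0 < ?r v" using that by (auto simp: card_gt_0_iff)
    moreover have "?r v \<le> card (set xs)" by (intro card_mono) auto
    ultimately show ?thesis using card_length[of xs] by simp
  qed
  then have "?r ` set xs \<subseteq> {1..length xs}" by blast
  moreover have "card (?r ` set xs) = card {1..length xs}"
    using inj assms by (simp add: card_image distinct_card)
  ultimately have "?r ` set xs = {1..length xs}" by (intro card_subset_eq) auto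
  then show ?thesis using assms inj by (simp add: standardize_def perms_iff distinct_map)
qed

lemma standardize_inject:
  assumes "standardize xs = standardize ys" "set xs = set ys"
  shows "xs = ys"
proof -
  have "map (\<lambda>v. card {w \<in> set xs. w \<le> v}) xs = map (\<lambda>v. card {w \<in> set xs. w \<le> v}) ys"
    using assms by (simp add: standardize_def)
  then show ?thesis
    using inj_on_map_eq_map[of "\<lambda>v. card {w \<in> set xs. w \<le> v}" xs ys]
      rank_inj_on[of "set xs"] assms(2) by simp
qed

lemma piece_props:
  assumes "\<pi> \<in> perms" "I \<subseteq> {..<length \<pi>}"
  shows "length (piece \<pi> I) = card I" "piece \<pi> I \<in> perms"
    and "emb (\<lambda>i. sorted_list_of_set I ! i) (piece \<pi> I) \<pi>"
    and "\<And>i. i < card I \<Longrightarrow> sorted_list_of_set I ! i \<in> I"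
proof -
  let ?l = "sorted_list_of_set I"
  let ?xs = "map ((!) \<pi>) ?l"
  have fin: "finite I" using assms(2) finite_subset by blast
  show len: "length (piece \<pi> I) = card I" by (simp add: piece_def standardize_def)
  have inj: "inj_on ((!) \<pi>) I"
    using assms by (intro inj_on_nth) (auto simp: perms_iff)
  then have "distinct ?xs" using fin by (simp add: distinct_map)
  then show "piece \<pi> I \<in> perms" unfolding piece_def by (rule standardize_perms)
  show mem: "?l ! i \<in> I" if "i < card I" for i
    using nth_mem[of i ?l] that fin by simp
  have "?l ! i < ?l ! j" if "i < j" "j < card I" for i j
    using sorted_wrt_nth_less[OF strict_sorted_list_of_set[of I] that(1)] that(2) by simp
  moreover have "piece \<pi> I ! i < piece \<pi> I ! j \<longleftrightarrow> \<pi> ! (?l ! i) < \<pi> ! (?l ! j)"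
    if "i < card I" "j < card I" for i j
    using that rank_less_iff[of "set ?xs" "\<pi> ! (?l ! i)" "\<pi> ! (?l ! j)"] fin mem
    by (simp add: piece_def standardize_def)
  moreover have "?l ! i < length \<pi>" if "i < card I" for i using mem[OF that] assms(2) by auto
  ultimately show "emb (\<lambda>i. ?l ! i) (piece \<pi> I) \<pi>" unfolding emb_def len by auto
qed

text \<open>A permutation can be read off at the positions \<open>I\<close> from its pattern there and the set of the values that
  it takes there.\<close>

lemma piece_inject:
  assumes "piece \<pi> I = piece \<sigma> I" "(!) \<pi> ` I = (!) \<sigma> ` I" "finite I" "i \<in> I"
  shows "\<pi> ! i = \<sigma> ! i"
proof -
  have "map ((!) \<pi>) (sorted_list_of_set I) = map ((!) \<sigma>) (sorted_list_of_set I)"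
    by (rule standardize_inject) (use assms in \<open>simp_all add: piece_def\<close>)
  then show ?thesis using assms(3,4) by simp
qed

section \<open>Counting permutations through their colour classes\<close>

text \<open>The sets of positions, or of values, of one colour in a colouring with few changes.\<close>

definition few_jumps :: "nat \<Rightarrow> nat \<Rightarrow> nat set set" where
  "few_jumps n s = {I. I \<subseteq> {..<n} \<and> card {p. 0 < p \<and> p < n \<and> (p \<in> I) \<noteq> (p - 1 \<in> I)} \<le> s}"

text \<open>When \<open>g\<close> enumerates the coordinate without gaps, a change of colour between neighbours needs a
  threshold exactly at the upper neighbour.\<close>

lemma cut_by_few_jumps:
  assumes "cut_by C (\<lambda>p. int (g p)) S c" "finite C" "card C \<le> s" "bij_betw g S {..<n}"
  shows "g ` {p \<in> S. c p} \<in> few_jumps n s"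
proof -
  let ?V = "g ` {p \<in> S. c p}"
  let ?J = "{v. 0 < v \<and> v < n \<and> (v \<in> ?V) \<noteq> (v - 1 \<in> ?V)}"
  have inj: "inj_on g S" and im: "g ` S = {..<n}" using assms(4) by (auto simp: bij_betw_def)
  have V: "g p \<in> ?V \<longleftrightarrow> c p" if "p \<in> S" for p
    using that inj by (auto dest: inj_onD)
  have "int ` ?J \<subseteq> C"
  proof
    fix t assume "t \<in> int ` ?J"
    then obtain v where v: "t = int v" "0 < v" "v < n" "(v \<in> ?V) \<noteq> (v - 1 \<in> ?V)" by blast
    have im': "v \<in> g ` S" "v - 1 \<in> g ` S" unfolding im using v(3) by simp_all
    obtain p where p: "p \<in> S" "g p = v" using im'(1) by (rule imageE) simp
    obtain q where q: "q \<in> S" "g q = v - 1" using im'(2) by (rule imageE) simp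
    note pq = p(1) q(1) p(2) q(2)
    then have "c p \<noteq> c q" using v(4) V[OF pq(1)] V[OF pq(2)] by simp
    then obtain t' where t': "t' \<in> C" "(t' \<le> int (g p)) \<noteq> (t' \<le> int (g q))"
      using cut_byD[OF assms(1) pq(1,2)] by blast
    then have "t' = int v" using v(2) by (auto simp: pq(3,4) of_nat_diff)
    then show "t \<in> C" using t' v by simp
  qed
  then have "card (int ` ?J) \<le> s" using card_mono[OF assms(2)] assms(3) le_trans by blast
  then have "card ?J \<le> s" by (simp add: card_image)
  moreover have "?V \<subseteq> {..<n}" using im by auto
  ultimately show ?thesis by (simp add: few_jumps_def)
qed

lemma card_small_subsets_le:
  "card {D. D \<subseteq> {..<n} \<and> card D \<le> s} \<le> (n + 1) ^ s"
proof -
  let ?L = "{xs. set xs \<subseteq> {..n} \<and> length xs = s}"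
  have "{D. D \<subseteq> {..<n} \<and> card D \<le> s} \<subseteq> (\<lambda>xs. set xs \<inter> {..<n}) ` ?L"
  proof
    fix D assume "D \<in> {D. D \<subseteq> {..<n} \<and> card D \<le> s}"
    then have D: "D \<subseteq> {..<n}" "card D \<le> s" "finite D" by (auto intro: finite_subset)
    \<comment> \<open>A subset with fewer elements is padded with the element n outside the range.\<close>
    define xs where "xs = sorted_list_of_set D @ replicate (s - card D) n"
    have "xs \<in> ?L" "D = set xs \<inter> {..<n}" using D by (auto simp: xs_def)
    then show "D \<in> (\<lambda>xs. set xs \<inter> {..<n}) ` ?L" by blast
  qed
  then have "card {D. D \<subseteq> {..<n} \<and> card D \<le> s} \<le> card ?L"
    by (rule surj_card_le[rotated]) (simp add: finite_lists_length_eq)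
  also have "\<dots> = (n + 1) ^ s" by (simp add: card_lists_length_eq)
  finally show ?thesis .
qed

lemma finite_few_jumps: "finite (few_jumps n s)"
  by (rule finite_subset[of _ "Pow {..<n}"]) (auto simp: few_jumps_def)

text \<open>A set is determined by its jumps and by whether it contains \<open>0\<close>.\<close>

lemma card_few_jumps_le: "card (few_jumps n s) \<le> 2 * (n + 1) ^ s"
proof -
  let ?J = "\<lambda>I. {p. 0 < p \<and> p < n \<and> (p \<in> I) \<noteq> (p - 1 \<in> I)}"
  let ?R = "(UNIV :: bool set) \<times> {D. D \<subseteq> {..<n} \<and> card D \<le> s}"
  have "inj_on (\<lambda>I. (0 \<in> I, ?J I)) (few_jumps n s)"
  proof (rule inj_onI)
    fix I K assume I: "I \<in> few_jumps n s" and K: "K \<in> few_jumps n s"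
      and e: "(0 \<in> I, ?J I) = (0 \<in> K, ?J K)"
    have "p < n \<longrightarrow> (p \<in> I \<longleftrightarrow> p \<in> K)" for p
    proof (induction p)
      case 0 then show ?case using e by simp
    next
      case (Suc p)
      have "Suc p \<in> ?J I \<longleftrightarrow> Suc p \<in> ?J K" using e by blast
      then show ?case using Suc by auto
    qed
    then show "I = K" using I K by (auto simp: few_jumps_def)
  qed
  moreover have "(\<lambda>I. (0 \<in> I, ?J I)) ` few_jumps n s \<subseteq> ?R" by (auto simp: few_jumps_def)
  moreover have "finite ?R" by (intro finite_cartesian_product) auto
  ultimately have "card (few_jumps n s) \<le> card ?R" by (rule card_inj_on_le)
  also have "\<dots> = 2 * card {D. D \<subseteq> {..<n} \<and> card D \<le> s}" by (simp add: card_cartesian_product)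
  also have "\<dots> \<le> 2 * (n + 1) ^ s" using card_small_subsets_le by simp
  finally show ?thesis .
qed

lemma perms_of_length_iff: "\<pi> \<in> perms_of_length n \<longleftrightarrow> \<pi> \<in> perms \<and> length \<pi> = n"
proof -
  have "length \<pi> = n" if "distinct \<pi>" "set \<pi> = {1..n}" using that distinct_card[of \<pi>] by simp
  then show ?thesis by (auto simp: perms_iff perms_of_length_def permutations_of_set_def)
qed

lemma finite_perms_of_length [simp]: "finite (perms_of_length n)"
  by (simp add: perms_of_length_def)

text \<open>The permutation is encoded by the positions \<open>I\<close> and the values of the first colour class, together with
  the patterns of both classes; the class of size \<open>k\<close> pairs with one of size \<open>n - k\<close>. Values are shifted down by one
  so that they, like positions, range over \<open>{..<n}\<close>.\<close>

lemma card_le_by_splitting: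
  assumes split: "\<And>\<pi>. \<pi> \<in> C \<inter> perms_of_length n \<Longrightarrow>
    \<exists>I\<in>few_jumps n s. (\<lambda>i. \<pi> ! i - 1) ` I \<in> few_jumps n s \<and>
      piece \<pi> I \<in> D \<and> piece \<pi> ({..<n} - I) \<in> D"
  shows "card (C \<inter> perms_of_length n) \<le> (2 * (n + 1) ^ s)\<^sup>2 *
    (\<Sum>k\<le>n. card (D \<inter> perms_of_length k) * card (D \<inter> perms_of_length (n - k)))"
proof -
  have "\<forall>\<pi>\<in>C \<inter> perms_of_length n. \<exists>I. I \<in> few_jumps n s \<and>
      (\<lambda>i. \<pi> ! i - 1) ` I \<in> few_jumps n s \<and> piece \<pi> I \<in> D \<and> piece \<pi> ({..<n} - I) \<in> D"
    using split by blast
  from bchoice[OF this] obtain I where I: "\<And>\<pi>. \<pi> \<in> C \<inter> perms_of_length n \<Longrightarrow> I \<pi> \<in> few_jumps n s \<and>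
      (\<lambda>i. \<pi> ! i - 1) ` I \<pi> \<in> few_jumps n s \<and> piece \<pi> (I \<pi>) \<in> D \<and> piece \<pi> ({..<n} - I \<pi>) \<in> D"
    by blast
  let ?\<Phi> = "\<lambda>\<pi>. ((I \<pi>, (\<lambda>i. \<pi> ! i - 1) ` I \<pi>), (piece \<pi> (I \<pi>), piece \<pi> ({..<n} - I \<pi>)))"
  let ?U = "\<Union>k\<le>n. (D \<inter> perms_of_length k) \<times> (D \<inter> perms_of_length (n - k))"
  let ?R = "(few_jumps n s \<times> few_jumps n s) \<times> ?U"
  have "inj_on ?\<Phi> (C \<inter> perms_of_length n)"
  proof (rule inj_onI)
    fix \<pi> \<sigma> assume \<pi>: "\<pi> \<in> C \<inter> perms_of_length n" and \<sigma>: "\<sigma> \<in> C \<inter> perms_of_length n"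
      and e: "?\<Phi> \<pi> = ?\<Phi> \<sigma>"
    define J where "J = I \<pi>"
    have J: "J \<subseteq> {..<n}" "I \<sigma> = J" using I[OF \<pi>] e by (auto simp: J_def few_jumps_def)
    have V: "(\<lambda>i. \<pi> ! i - 1) ` J = (\<lambda>i. \<sigma> ! i - 1) ` J" using e J by (simp add: J_def)
    have p: "piece \<pi> J = piece \<sigma> J" "piece \<pi> ({..<n} - J) = piece \<sigma> ({..<n} - J)"
      using e J by (simp_all add: J_def)
    have Suc: "(!) \<tau> ` J = Suc ` (\<lambda>i. \<tau> ! i - 1) ` J" if "\<tau> \<in> perms_of_length n" for \<tau>
    proof -
      have "Suc (\<tau> ! i - 1) = \<tau> ! i" if "i \<in> J" for i
        using perms_nth[of \<tau> i] J that \<open>\<tau> \<in> perms_of_length n\<close> by (auto simp: perms_of_length_iff)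
      then show ?thesis by (force simp: image_image)
    qed
    have im: "(!) \<pi> ` J = (!) \<sigma> ` J" using Suc[of \<pi>] Suc[of \<sigma>] \<pi> \<sigma> V by simp
    have inj: "inj_on ((!) \<tau>) {..<n}" and full: "(!) \<tau> ` {..<n} = {1..n}" if "\<tau> \<in> perms_of_length n" for \<tau>
    proof -
      have \<tau>: "distinct \<tau>" "set \<tau> = {1..length \<tau>}" "length \<tau> = n" using that by (auto simp: perms_of_length_iff perms_iff)
      show "inj_on ((!) \<tau>) {..<n}" using \<tau> by (intro inj_on_nth) auto
      show "(!) \<tau> ` {..<n} = {1..n}" using \<tau> nth_image[of n \<tau>] by (simp add: atLeast0LessThan)
    qed
    have "(!) \<tau> ` ({..<n} - J) = {1..n} - (!) \<tau> ` J" if "\<tau> \<in> perms_of_length n" for \<tau>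
      using inj_on_image_set_diff[OF inj[OF that], of "{..<n}" J] J full[OF that] by auto
    then have im': "(!) \<pi> ` ({..<n} - J) = (!) \<sigma> ` ({..<n} - J)" using im \<pi> \<sigma> by simp
    have "\<pi> ! i = \<sigma> ! i" if "i < n" for i
    proof (cases "i \<in> J")
      case True
      show ?thesis by (rule piece_inject[OF p(1) im]) (use True J in \<open>auto intro: finite_subset\<close>)
    next
      case False
      show ?thesis by (rule piece_inject[OF p(2) im']) (use False that in auto)
    qed
    then show "\<pi> = \<sigma>" using \<pi> \<sigma> by (intro nth_equalityI) (auto simp: perms_of_length_iff)
  qed
  moreover have "?\<Phi> ` (C \<inter> perms_of_length n) \<subseteq> ?R"
  proof (rule image_subsetI)
    fix \<pi> assume \<pi>: "\<pi> \<in> C \<inter> perms_of_length n"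
    note J = I[OF \<pi>]
    have sub: "I \<pi> \<subseteq> {..<n}" using J by (simp add: few_jumps_def)
    then have k: "card (I \<pi>) \<le> n" using card_mono[of "{..<n}"] by simp
    have "card ({..<n} - I \<pi>) = n - card (I \<pi>)"
      using card_Diff_subset[of "I \<pi>" "{..<n}"] sub finite_subset[OF sub] by simp
    then have "piece \<pi> (I \<pi>) \<in> perms_of_length (card (I \<pi>))"
      "piece \<pi> ({..<n} - I \<pi>) \<in> perms_of_length (n - card (I \<pi>))"
      using piece_props(1,2)[of \<pi> "I \<pi>"] piece_props(1,2)[of \<pi> "{..<n} - I \<pi>"] sub \<pi>
      by (auto simp: perms_of_length_iff)
    then show "?\<Phi> \<pi> \<in> ?R" using J k by auto
  qed
  moreover have "finite ?R"
    by (intro finite_cartesian_product finite_UN_I finite_few_jumps finite_Int disjI2) auto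
  ultimately have "card (C \<inter> perms_of_length n) \<le> card ?R" by (rule card_inj_on_le)
  also have "\<dots> = (card (few_jumps n s))\<^sup>2 * card ?U"
    by (simp add: card_cartesian_product power2_eq_square)
  also have "\<dots> \<le> (2 * (n + 1) ^ s)\<^sup>2 *
      (\<Sum>k\<le>n. card ((D \<inter> perms_of_length k) \<times> (D \<inter> perms_of_length (n - k))))"
    by (intro mult_mono power_mono card_few_jumps_le card_UN_le) auto
  finally show ?thesis by (simp add: card_cartesian_product)
qed

section \<open>Growth rates\<close>

text \<open>If \<open>b\<close> is bounded by a multiple of \<open>r ^ n\<close>, then its convolution square is bounded by a polynomial
  times \<open>r ^ n\<close>, and neither this factor nor \<open>exp (h n)\<close> survives the \<open>n\<close>-th root.\<close>

lemma limsup_root_le_of_convolution: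
  fixes a b :: "nat \<Rightarrow> nat" and h :: "nat \<Rightarrow> real"
  assumes ab: "\<And>n. real (a n) \<le> exp (h n) * real (\<Sum>k\<le>n. b k * b (n - k))"
    and h: "(\<lambda>n. h n / real n) \<longlonglongrightarrow> 0"
  shows "limsup (\<lambda>n. ereal (root n (real (a n)))) \<le> limsup (\<lambda>n. ereal (root n (real (b n))))"
proof (rule dense_ge)
  fix z assume z: "limsup (\<lambda>n. ereal (root n (real (b n)))) < z"
  have nonneg: "0 \<le> limsup (\<lambda>n. ereal (root n (real (b n))))"
    by (rule le_Limsup) (auto simp: real_root_ge_zero)
  show "limsup (\<lambda>n. ereal (root n (real (a n)))) \<le> z"
  proof (cases z)
    case (real r)
    have r: "0 < r" using nonneg z real by (metis ereal_less(2) order_le_less_trans)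
    have "eventually (\<lambda>n. ereal (root n (real (b n))) < ereal r) sequentially"
      using z real by (intro Limsup_lessD) simp
    then obtain N where N: "\<And>n. N \<le> n \<Longrightarrow> root n (real (b n)) < r"
      by (auto simp: eventually_sequentially)
    \<comment> \<open>The finitely many indices up to N are absorbed into the constant K.\<close>
    define K where "K = 1 + (\<Sum>k\<le>N. real (b k) / r ^ k)"
    have K: "1 \<le> K" using r by (simp add: K_def sum_nonneg)
    have bK: "real (b k) \<le> K * r ^ k" for k
    proof (cases "k \<le> N")
      case True
      then have "real (b k) / r ^ k \<le> (\<Sum>k\<le>N. real (b k) / r ^ k)"
        using r by (intro member_le_sum) auto
      then have "real (b k) / r ^ k \<le> K" by (simp add: K_def)
      then show ?thesis using r by (simp add: pos_divide_le_eq)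
    next
      case False
      then have "real (b k) = root k (real (b k)) ^ k" by simp
      also have "\<dots> \<le> r ^ k" using N[of k] False by (intro power_mono) (auto simp: real_root_ge_zero)
      also have "\<dots> \<le> K * r ^ k" using K r by simp
      finally show ?thesis .
    qed
    define t where "t = (\<lambda>n. h n + ln (real n + 1) + 2 * ln K)"
    have "real (a n) \<le> exp (t n) * r ^ n" for n
    proof -
      have "real (\<Sum>k\<le>n. b k * b (n - k)) \<le> (\<Sum>k\<le>n. K\<^sup>2 * r ^ n)"
        unfolding of_nat_sum
      proof (rule sum_mono)
        fix k assume "k \<in> {..n}"
        then have "r ^ k * r ^ (n - k) = r ^ n" by (simp flip: power_add)
        moreover have "real (b k) * real (b (n - k)) \<le> (K * r ^ k) * (K * r ^ (n - k))"
          using bK K r by (intro mult_mono) auto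
        moreover have "(K * r ^ k) * (K * r ^ (n - k)) = K\<^sup>2 * (r ^ k * r ^ (n - k))"
          by (simp add: power2_eq_square)
        ultimately show "real (b k * b (n - k)) \<le> K\<^sup>2 * r ^ n" by simp
      qed
      then have "real (\<Sum>k\<le>n. b k * b (n - k)) \<le> (real n + 1) * K\<^sup>2 * r ^ n"
        by (simp add: algebra_simps)
      then have "real (a n) \<le> exp (h n) * ((real n + 1) * K\<^sup>2 * r ^ n)"
        using ab[of n] by (meson exp_ge_zero mult_left_mono order_trans)
      moreover have "exp (t n) = exp (h n) * (real n + 1) * K\<^sup>2"
      proof -
        have "exp (2 * ln K) = K\<^sup>2" using K by (simp add: exp_double)
        then show ?thesis by (simp add: t_def exp_add)
      qed
      ultimately show ?thesis by (simp add: mult.assoc)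
    qed
    then have "root n (real (a n)) \<le> exp (t n / real n) * r" if "0 < n" for n
    proof -
      assume le: "\<And>n. real (a n) \<le> exp (t n) * r ^ n"
      have "exp (t n / real n) ^ n = exp (t n)" using that by (simp flip: exp_of_nat_mult)
      then have "(exp (t n / real n) * r) ^ n = exp (t n) * r ^ n" by (simp add: power_mult_distrib)
      then have "root n (exp (t n) * r ^ n) = exp (t n / real n) * r"
        using that r by (intro real_root_pos_unique) auto
      then show ?thesis using real_root_le_mono[OF that le[of n]] by simp
    qed
    then have "eventually (\<lambda>n. ereal (root n (real (a n))) \<le> ereal (exp (t n / real n) * r)) sequentially"
      by (intro eventually_sequentiallyI[of 1]) simp
    then have "limsup (\<lambda>n. ereal (root n (real (a n)))) \<le> limsup (\<lambda>n. ereal (exp (t n / real n) * r))"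
      by (rule Limsup_mono)
    also have "\<dots> = ereal r"
    proof -
      have "(\<lambda>n. (ln (real n + 1) + 2 * ln K) / real n) \<longlonglongrightarrow> 0" by real_asymp
      from tendsto_add[OF h this] have "(\<lambda>n. t n / real n) \<longlonglongrightarrow> 0"
        by (simp add: t_def add_divide_distrib add.assoc)
      then have "(\<lambda>n. exp (t n / real n) * r) \<longlonglongrightarrow> exp 0 * r" by (intro tendsto_intros)
      then have "(\<lambda>n. ereal (exp (t n / real n) * r)) \<longlonglongrightarrow> ereal r" by simp
      then show ?thesis by (rule lim_imp_Limsup[rotated]) simp
    qed
    finally show ?thesis using real by simp
  qed (use z nonneg in auto)
qed

text \<open>With \<open>m\<close> of order \<open>\<surd>n\<close> the number of admissible pairs of sets is \<open>exp (O(\<surd>n log n))\<close>. The side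
  length \<open>m\<close> is a parameter of the hypothesis in order to keep square roots out of the combinatorial
  part.\<close>

lemma growth_rate_le_of_splitting:
  assumes split: "\<And>\<pi> m. \<pi> \<in> C \<Longrightarrow> \<pi> \<in> perms \<Longrightarrow> length \<pi> \<le> m * m \<Longrightarrow>
    \<exists>I\<in>few_jumps (length \<pi>) (6 * m + 1). (\<lambda>i. \<pi> ! i - 1) ` I \<in> few_jumps (length \<pi>) (6 * m + 1) \<and>
      piece \<pi> I \<in> D \<and> piece \<pi> ({..<length \<pi>} - I) \<in> D"
  shows "growth_rate C \<le> growth_rate D"
proof -
  define m where "m = (\<lambda>n. nat \<lceil>sqrt (real n)\<rceil>)"
  have m: "n \<le> m n * m n" for n
  proof -
    have "sqrt (real n) \<le> real (m n)" by (simp add: m_def real_nat_ceiling_ge)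
    then have "sqrt (real n) * sqrt (real n) \<le> real (m n) * real (m n)" by (intro mult_mono) auto
    then have "real n \<le> real (m n * m n)" by simp
    then show ?thesis by (simp only: of_nat_le_iff)
  qed
  have m_le: "real (m n) \<le> sqrt (real n) + 1" for n
    using of_int_ceiling_le_add_one[of "sqrt (real n)"] by (simp add: m_def)
  define h where "h = (\<lambda>n. 2 * ln 2 + 2 * real (6 * m n + 1) * ln (real n + 1))"
  have "card (C \<inter> perms_of_length n) \<le> (2 * (n + 1) ^ (6 * m n + 1))\<^sup>2 *
      (\<Sum>k\<le>n. card (D \<inter> perms_of_length k) * card (D \<inter> perms_of_length (n - k)))" for n
  proof (rule card_le_by_splitting)
    fix \<pi> assume "\<pi> \<in> C \<inter> perms_of_length n"
    then show "\<exists>I\<in>few_jumps n (6 * m n + 1). (\<lambda>i. \<pi> ! i - 1) ` I \<in> few_jumps n (6 * m n + 1) \<and>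
        piece \<pi> I \<in> D \<and> piece \<pi> ({..<n} - I) \<in> D"
      using split[of \<pi> "m n"] m[of n] by (auto simp: perms_of_length_iff)
  qed
  moreover have square: "real ((2 * (n + 1) ^ s)\<^sup>2) = exp (2 * ln 2 + 2 * real s * ln (real n + 1))" for n s
  proof -
    have "exp (real (2 * s) * ln (real n + 1)) = (real n + 1) ^ (2 * s)"
      unfolding exp_of_nat_mult by simp
    moreover have "exp (2 * ln (2 :: real)) = 4" by (simp add: exp_double)
    moreover have "real ((2 * (n + 1) ^ s)\<^sup>2) = 4 * (real n + 1) ^ (2 * s)"
      by (simp add: power_mult_distrib power_even_eq add.commute)
    ultimately show ?thesis by (simp add: exp_add)
  qed
  ultimately have "real (card (C \<inter> perms_of_length n)) \<le> exp (h n) *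
      real (\<Sum>k\<le>n. card (D \<inter> perms_of_length k) * card (D \<inter> perms_of_length (n - k)))" for n
    unfolding h_def square[symmetric] of_nat_mult[symmetric] of_nat_le_iff by blast
  moreover have "(\<lambda>n. h n / real n) \<longlonglongrightarrow> 0"
  proof (rule tendsto_sandwich[of "\<lambda>_. 0"])
    show "(\<lambda>n. (2 * ln 2 + 2 * (6 * (sqrt (real n) + 1) + 1) * ln (real n + 1)) / real n) \<longlonglongrightarrow> 0"
      by real_asymp
    show "\<forall>\<^sub>F n in sequentially. h n / real n \<le>
        (2 * ln 2 + 2 * (6 * (sqrt (real n) + 1) + 1) * ln (real n + 1)) / real n"
    proof (rule always_eventually, rule allI, rule divide_right_mono)
      fix n
      have "2 * real (6 * m n + 1) \<le> 2 * (6 * (sqrt (real n) + 1) + 1)" using m_le[of n] by simp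
      then show "h n \<le> 2 * ln 2 + 2 * (6 * (sqrt (real n) + 1) + 1) * ln (real n + 1)"
        unfolding h_def by (intro add_left_mono mult_right_mono) auto
    qed simp
    show "\<forall>\<^sub>F n in sequentially. 0 \<le> h n / real n"
      by (rule always_eventually) (simp add: h_def)
  qed simp
  ultimately show ?thesis unfolding growth_rate_def by (rule limsup_root_le_of_convolution)
qed

lemma growth_rate_mono: "C \<subseteq> D \<Longrightarrow> growth_rate C \<le> growth_rate D"
  unfolding growth_rate_def
proof (rule Limsup_mono, rule eventually_sequentiallyI[of 1])
  fix n :: nat assume "C \<subseteq> D" "1 \<le> n"
  then have "real (card (C \<inter> perms_of_length n)) \<le> real (card (D \<inter> perms_of_length n))"
    by (auto intro!: card_mono)
  then show "ereal (root n (real (card (C \<inter> perms_of_length n)))) \<le>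
      ereal (root n (real (card (D \<inter> perms_of_length n))))"
    using \<open>1 \<le> n\<close> by simp
qed

lemma growth_rate_bounded_length:
  assumes "\<And>\<pi>. \<pi> \<in> C \<Longrightarrow> length \<pi> < N"
  shows "growth_rate C = 0"
proof -
  have "C \<inter> perms_of_length n = {}" if "N \<le> n" for n
    using that assms by (force simp: perms_of_length_iff)
  then have "limsup (\<lambda>n. ereal (root n (real (card (C \<inter> perms_of_length n))))) = limsup (\<lambda>n. ereal 0)"
    by (intro Limsup_eq eventually_sequentiallyI[of N]) simp
  then show ?thesis by (simp add: growth_rate_def Limsup_const zero_ereal_def)
qed

section \<open>Removing one articulation point\<close>

lemma Av_closed:
  assumes "\<pi> \<in> Av B" "\<sigma> \<in> perms" "\<sigma> \<preceq>\<^sub>p \<pi>"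
  shows "\<sigma> \<in> Av B"
  using assms involved_trans by (auto simp: Av_def)

lemma I2_no321:
  assumes "\<pi> \<in> I2"
  shows "no321 int (\<lambda>i. int (\<pi> ! i - 1)) {..<length \<pi>}"
  unfolding no321_def
proof (intro ballI impI notI)
  fix p q r assume *: "p \<in> {..<length \<pi>}" "q \<in> {..<length \<pi>}" "r \<in> {..<length \<pi>}"
    "int p < int q" "int q < int r" "int (\<pi> ! q - 1) < int (\<pi> ! p - 1)" "int (\<pi> ! r - 1) < int (\<pi> ! q - 1)"
  have "emb (\<lambda>i. [p, q, r] ! i) [3, 2, 1] \<pi>"
    using * by (auto simp: emb_def less_Suc_eq numeral_3_eq_3)
  then have "[3, 2, 1] \<preceq>\<^sub>p \<pi>" by (auto simp: involved_iff_emb)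
  then show False using assms by (simp add: I2_def Av_def)
qed

lemma perms_coordinates:
  assumes "\<pi> \<in> perms"
  shows "bij_betw (\<lambda>i. \<pi> ! i - 1) {..<length \<pi>} {..<length \<pi>}"
    and "inj_on (\<lambda>i. int (\<pi> ! i - 1)) {..<length \<pi>}"
    and "\<And>i j. i < length \<pi> \<Longrightarrow> j < length \<pi> \<Longrightarrow> \<pi> ! i - 1 < \<pi> ! j - 1 \<longleftrightarrow> \<pi> ! i < \<pi> ! j"
proof -
  have d: "distinct \<pi>" using assms by (simp add: perms_iff)
  show less: "\<pi> ! i - 1 < \<pi> ! j - 1 \<longleftrightarrow> \<pi> ! i < \<pi> ! j" if "i < length \<pi>" "j < length \<pi>" for i j
    using perms_nth[OF assms that(1)] perms_nth[OF assms that(2)] by linarith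
  have inj: "inj_on (\<lambda>i. \<pi> ! i - 1) {..<length \<pi>}"
  proof (rule inj_onI)
    fix i j assume *: "i \<in> {..<length \<pi>}" "j \<in> {..<length \<pi>}" "\<pi> ! i - 1 = \<pi> ! j - 1"
    then have "0 < \<pi> ! i" "0 < \<pi> ! j" using perms_nth[OF assms] by auto
    then have "\<pi> ! i = \<pi> ! j" using *(3) by linarith
    then show "i = j" using * d by (simp add: nth_eq_iff_index_eq)
  qed
  have "(\<lambda>i. \<pi> ! i - 1) ` {..<length \<pi>} \<subseteq> {..<length \<pi>}"
  proof (rule image_subsetI)
    fix i assume "i \<in> {..<length \<pi>}"
    then show "\<pi> ! i - 1 \<in> {..<length \<pi>}" using perms_nth[OF assms, of i] by simp linarith
  qed
  then show "bij_betw (\<lambda>i. \<pi> ! i - 1) {..<length \<pi>} {..<length \<pi>}"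
    using inj by (simp add: bij_betw_def endo_inj_surj)
  show "inj_on (\<lambda>i. int (\<pi> ! i - 1)) {..<length \<pi>}"
    using inj by (auto simp: inj_on_def)
qed

text \<open>The bound \<open>6 * m + 1\<close> is the number of thresholds that \<open>quadrant_coloring\<close> provides.\<close>

definition splittable :: "nat list \<Rightarrow> nat list \<Rightarrow> nat \<Rightarrow> bool" where
  "splittable \<gamma> \<pi> m \<longleftrightarrow> (\<exists>c C D. finite C \<and> finite D \<and> card C \<le> 6 * m + 1 \<and> card D \<le> 6 * m + 1 \<and>
     cut_by C int {..<length \<pi>} c \<and> cut_by D (\<lambda>i. int (\<pi> ! i - 1)) {..<length \<pi>} c \<and>
     (\<forall>e. emb e \<gamma> \<pi> \<longrightarrow> (\<exists>i<length \<gamma>. c (e i)) \<and> (\<exists>i<length \<gamma>. \<not> c (e i))))"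

text \<open>The pattern of a colour class is involved in the permutation, so it inherits the avoidance of 321 and
  of \<open>Y\<close>; a copy of \<open>\<gamma>\<close> in it would be a monochromatic copy.\<close>

lemma growth_rate_le_of_splittable:
  assumes "\<And>\<pi> m. \<pi> \<in> I2 \<inter> Av (insert \<gamma>' Y) \<Longrightarrow> length \<pi> \<le> m * m \<Longrightarrow> splittable \<gamma> \<pi> m"
  shows "growth_rate (I2 \<inter> Av (insert \<gamma>' Y)) \<le> growth_rate (I2 \<inter> Av (insert \<gamma> Y))"
proof (rule growth_rate_le_of_splitting)
  fix \<pi> m assume \<pi>: "\<pi> \<in> I2 \<inter> Av (insert \<gamma>' Y)" "\<pi> \<in> perms" "length \<pi> \<le> m * m"
  obtain c C D where c: "finite C" "finite D" "card C \<le> 6 * m + 1" "card D \<le> 6 * m + 1"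
    "cut_by C int {..<length \<pi>} c" "cut_by D (\<lambda>i. int (\<pi> ! i - 1)) {..<length \<pi>} c"
    "\<And>e. emb e \<gamma> \<pi> \<Longrightarrow> (\<exists>i<length \<gamma>. c (e i)) \<and> (\<exists>i<length \<gamma>. \<not> c (e i))"
    using assms[OF \<pi>(1,3)] unfolding splittable_def by blast
  define I where "I = {i \<in> {..<length \<pi>}. c i}"
  have "(\<lambda>i. i) ` {i \<in> {..<length \<pi>}. c i} \<in> few_jumps (length \<pi>) (6 * m + 1)"
    by (rule cut_by_few_jumps[OF _ c(1,3)]) (use c(5) in \<open>auto simp: bij_betw_def\<close>)
  then have "I \<in> few_jumps (length \<pi>) (6 * m + 1)" by (simp add: I_def)
  moreover have "(\<lambda>i. \<pi> ! i - 1) ` I \<in> few_jumps (length \<pi>) (6 * m + 1)"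
    unfolding I_def by (rule cut_by_few_jumps[OF c(6) c(2,4) perms_coordinates(1)[OF \<pi>(2)]])
  moreover have good: "piece \<pi> J \<in> I2 \<inter> Av (insert \<gamma> Y)"
    if J: "J \<subseteq> {..<length \<pi>}" and mono: "(\<forall>j\<in>J. c j) \<or> (\<forall>j\<in>J. \<not> c j)" for J
  proof -
    note p = piece_props[OF \<pi>(2) J]
    have inv: "piece \<pi> J \<preceq>\<^sub>p \<pi>" using p(3) by (auto simp: involved_iff_emb)
    have "piece \<pi> J \<in> I2" "piece \<pi> J \<in> Av (insert \<gamma>' Y)"
      using \<pi>(1) Av_closed[OF _ p(2) inv] by (auto simp: I2_def)
    moreover have "\<not> \<gamma> \<preceq>\<^sub>p piece \<pi> J"
    proof
      assume "\<gamma> \<preceq>\<^sub>p piece \<pi> J"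
      then obtain e where e: "emb e \<gamma> (piece \<pi> J)" by (auto simp: involved_iff_emb)
      have "sorted_list_of_set J ! e i \<in> J" if "i < length \<gamma>" for i
        using p(1,4) e that by (auto simp: emb_def)
      then show False using c(7)[OF emb_trans[OF e p(3)]] mono by blast
    qed
    ultimately show ?thesis by (auto simp: Av_def)
  qed
  moreover have "piece \<pi> I \<in> I2 \<inter> Av (insert \<gamma> Y)" by (rule good) (auto simp: I_def)
  moreover have "piece \<pi> ({..<length \<pi>} - I) \<in> I2 \<inter> Av (insert \<gamma> Y)" by (rule good) (auto simp: I_def)
  ultimately show "\<exists>I\<in>few_jumps (length \<pi>) (6 * m + 1).
      (\<lambda>i. \<pi> ! i - 1) ` I \<in> few_jumps (length \<pi>) (6 * m + 1) \<and>
      piece \<pi> I \<in> I2 \<inter> Av (insert \<gamma> Y) \<and> piece \<pi> ({..<length \<pi>} - I) \<in> I2 \<inter> Av (insert \<gamma> Y)"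
    by blast
qed

lemma involved_dsum_point:
  assumes "\<alpha> \<in> perms" "\<beta> \<in> perms" "emb e \<alpha> \<pi>" "emb f \<beta> \<pi>" "p < length \<pi>"
    and below: "\<And>i. i < length \<alpha> \<Longrightarrow> e i < p \<and> \<pi> ! e i < \<pi> ! p"
    and above: "\<And>j. j < length \<beta> \<Longrightarrow> p < f j \<and> \<pi> ! p < \<pi> ! f j"
  shows "\<alpha> \<oplus>\<^sub>p [Suc 0] \<oplus>\<^sub>p \<beta> \<preceq>\<^sub>p \<pi>"
proof -
  let ?g = "\<lambda>i. if i < length [Suc 0] then p else f (i - length [Suc 0])"
  have "emb (\<lambda>_. p) [Suc 0] \<pi>" using assms(5) by (simp add: emb_def)
  from emb_dsumI[OF one_perms assms(2) this assms(4)]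
  have g: "emb ?g ([Suc 0] \<oplus>\<^sub>p \<beta>) \<pi>" using above by auto
  have "\<exists>h. emb h (\<alpha> \<oplus>\<^sub>p [Suc 0] \<oplus>\<^sub>p \<beta>) \<pi>"
  proof (rule exI, rule emb_dsumI[OF assms(1) dsum_perms[OF one_perms assms(2)] assms(3) g])
    fix i j assume ij: "i < length \<alpha>" "j < length ([Suc 0] \<oplus>\<^sub>p \<beta>)"
    show "e i < ?g j \<and> \<pi> ! e i < \<pi> ! ?g j"
    proof (cases j)
      case 0 then show ?thesis using below[OF ij(1)] by simp
    next
      case (Suc j')
      then have "j' < length \<beta>" using ij by simp
      then show ?thesis using below[OF ij(1)] above[of j'] Suc by auto
    qed
  qed
  then show ?thesis by (simp add: involved_iff_emb)
qed

text \<open>Suppose that an entry \<open>p\<close> of the \<open>\<alpha>\<close>-part of one copy of \<open>\<alpha> \<oplus> \<beta>\<close> dominates the \<open>\<alpha>\<close>-part of another copy.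
  Then this second \<open>\<alpha>\<close>-part, \<open>p\<close>, and the \<open>\<beta>\<close>-part of the first copy form \<open>\<alpha> \<oplus> 1 \<oplus> \<beta>\<close>. So the
  \<open>\<alpha>\<close>-parts satisfy the hypotheses of \<open>splitting_coloring\<close>.\<close>

lemma splittable_after:
  assumes \<alpha>: "\<alpha> \<in> perms" "\<alpha> \<noteq> []" and \<beta>: "\<beta> \<in> perms"
    and no_max: "\<And>i. i < length \<alpha> \<Longrightarrow> \<exists>j<length \<alpha>. i < j \<or> \<alpha> ! i < \<alpha> ! j"
    and \<pi>: "\<pi> \<in> I2" "\<not> \<alpha> \<oplus>\<^sub>p [Suc 0] \<oplus>\<^sub>p \<beta> \<preceq>\<^sub>p \<pi>" "length \<pi> \<le> m * m"
  shows "splittable (\<alpha> \<oplus>\<^sub>p \<beta>) \<pi> m"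
proof -
  have perm: "\<pi> \<in> perms" using \<pi>(1) by (simp add: I2_def Av_def)
  let ?y = "\<lambda>i. int (\<pi> ! i - 1)"
  note y_less = perms_coordinates(3)[OF perm]
  define F where "F = {e ` {..<length \<alpha>} | e. emb e (\<alpha> \<oplus>\<^sub>p \<beta>) \<pi>}"
  have "\<exists>c C D. finite C \<and> finite D \<and> card C \<le> 6 * m + 1 \<and> card D \<le> 6 * m + 1 \<and>
    cut_by C int {..<length \<pi>} c \<and> cut_by D ?y {..<length \<pi>} c \<and>
    (\<forall>A\<in>F. (\<exists>p\<in>A. c p) \<and> (\<exists>p\<in>A. \<not> c p))"
  proof (rule splitting_coloring)
    fix A assume "A \<in> F"
    then obtain e where "A = e ` {..<length \<alpha>}" "emb e \<alpha> \<pi>"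
      using emb_dsumD(1)[OF \<alpha>(1) \<beta>] by (auto simp: F_def)
    then show "A \<subseteq> {..<length \<pi>} \<and> A \<noteq> {}" using \<alpha>(2) by (auto simp: emb_def)
  next
    fix A p assume "A \<in> F" "p \<in> A"
    then obtain e i where e: "A = e ` {..<length \<alpha>}" "emb e \<alpha> \<pi>" "i < length \<alpha>" "p = e i"
      using emb_dsumD(1)[OF \<alpha>(1) \<beta>] by (auto simp: F_def)
    obtain j where j: "j < length \<alpha>" "i < j \<or> \<alpha> ! i < \<alpha> ! j" using no_max[OF e(3)] by blast
    then have "e i < e j \<or> \<pi> ! e i < \<pi> ! e j" "e i < length \<pi>" "e j < length \<pi>"
      using e(2,3) by (auto simp: emb_def)
    then have "int p < int (e j) \<or> ?y p < ?y (e j)" using y_less e(4) by simp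
    moreover have "e j \<in> A" using e(1) j(1) by simp
    ultimately show "\<exists>q\<in>A. int p < int q \<or> ?y p < ?y q" by blast
  next
    fix A A' p assume "A \<in> F" "A' \<in> F" "p \<in> A'"
    then obtain e e' i where e: "A = e ` {..<length \<alpha>}" "emb e (\<alpha> \<oplus>\<^sub>p \<beta>) \<pi>"
      "emb e' (\<alpha> \<oplus>\<^sub>p \<beta>) \<pi>" "i < length \<alpha>" "p = e' i"
      by (auto simp: F_def)
    note d = emb_dsumD[OF \<alpha>(1) \<beta> e(2)] and d' = emb_dsumD[OF \<alpha>(1) \<beta> e(3)]
    have p: "p < length \<pi>" using d'(1) e(4,5) by (simp add: emb_def)
    show "\<not> (\<forall>q\<in>A. int q < int p \<and> ?y q < ?y p)"
    proof
      assume dom: "\<forall>q\<in>A. int q < int p \<and> ?y q < ?y p"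
      have "e k < p \<and> \<pi> ! e k < \<pi> ! p" if "k < length \<alpha>" for k
      proof -
        have "e k \<in> A" "e k < length \<pi>" using d(1) that e(1) by (auto simp: emb_def)
        then show ?thesis using dom y_less[of "e k" p] p by auto
      qed
      then have "\<alpha> \<oplus>\<^sub>p [Suc 0] \<oplus>\<^sub>p \<beta> \<preceq>\<^sub>p \<pi>"
        using involved_dsum_point[OF \<alpha>(1) \<beta> d(1) d'(2) p] d'(3)[OF e(4)] e(5) by blast
      then show False using \<pi>(2) by blast
    qed
  qed (use \<pi> perm I2_no321 perms_coordinates(2) in auto)
  then obtain c C D where c: "finite C" "finite D" "card C \<le> 6 * m + 1" "card D \<le> 6 * m + 1"
    "cut_by C int {..<length \<pi>} c" "cut_by D ?y {..<length \<pi>} c"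
    "\<And>A. A \<in> F \<Longrightarrow> (\<exists>p\<in>A. c p) \<and> (\<exists>p\<in>A. \<not> c p)" by blast
  have "(\<exists>i<length (\<alpha> \<oplus>\<^sub>p \<beta>). c (e i)) \<and> (\<exists>i<length (\<alpha> \<oplus>\<^sub>p \<beta>). \<not> c (e i))"
    if "emb e (\<alpha> \<oplus>\<^sub>p \<beta>) \<pi>" for e
  proof -
    have "e ` {..<length \<alpha>} \<in> F" using that by (auto simp: F_def)
    from c(7)[OF this] obtain i j where "i < length \<alpha>" "c (e i)" "j < length \<alpha>" "\<not> c (e j)" by auto
    then show ?thesis unfolding length_dsum by (meson trans_less_add1)
  qed
  with c(1-6) have "finite C \<and> finite D \<and> card C \<le> 6 * m + 1 \<and> card D \<le> 6 * m + 1 \<and>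
     cut_by C int {..<length \<pi>} c \<and> cut_by D ?y {..<length \<pi>} c \<and>
     (\<forall>e. emb e (\<alpha> \<oplus>\<^sub>p \<beta>) \<pi> \<longrightarrow>
       (\<exists>i<length (\<alpha> \<oplus>\<^sub>p \<beta>). c (e i)) \<and> (\<exists>i<length (\<alpha> \<oplus>\<^sub>p \<beta>). \<not> c (e i)))"
    by (intro conjI allI impI) auto
  then show ?thesis unfolding splittable_def by (intro exI)
qed

text \<open>The same with \<open>\<beta>\<close>-parts: an entry \<open>p\<close> of one of them that is dominated by all of another one lies above
  the \<open>\<alpha>\<close>-part of its own copy.\<close>

lemma splittable_before:
  assumes \<alpha>: "\<alpha> \<in> perms" and \<beta>: "\<beta> \<in> perms" "\<beta> \<noteq> []"
    and no_min: "\<And>i. i < length \<beta> \<Longrightarrow> \<exists>j<length \<beta>. j < i \<or> \<beta> ! j < \<beta> ! i"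
    and \<pi>: "\<pi> \<in> I2" "\<not> \<alpha> \<oplus>\<^sub>p [Suc 0] \<oplus>\<^sub>p \<beta> \<preceq>\<^sub>p \<pi>" "length \<pi> \<le> m * m"
  shows "splittable (\<alpha> \<oplus>\<^sub>p \<beta>) \<pi> m"
proof -
  have perm: "\<pi> \<in> perms" using \<pi>(1) by (simp add: I2_def Av_def)
  let ?y = "\<lambda>i. int (\<pi> ! i - 1)"
  note y_less = perms_coordinates(3)[OF perm]
  define F where "F = {(\<lambda>j. e (length \<alpha> + j)) ` {..<length \<beta>} | e. emb e (\<alpha> \<oplus>\<^sub>p \<beta>) \<pi>}"
  have "\<exists>c C D. finite C \<and> finite D \<and> card C \<le> 6 * m + 1 \<and> card D \<le> 6 * m + 1 \<and>
    cut_by C int {..<length \<pi>} c \<and> cut_by D ?y {..<length \<pi>} c \<and>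
    (\<forall>A\<in>F. (\<exists>p\<in>A. c p) \<and> (\<exists>p\<in>A. \<not> c p))"
  proof (rule splitting_coloring_dual)
    fix A assume "A \<in> F"
    then obtain e where "A = (\<lambda>j. e (length \<alpha> + j)) ` {..<length \<beta>}" "emb (\<lambda>j. e (length \<alpha> + j)) \<beta> \<pi>"
      using emb_dsumD(2)[OF \<alpha> \<beta>(1)] by (auto simp: F_def)
    then show "A \<subseteq> {..<length \<pi>} \<and> A \<noteq> {}" using \<beta>(2) by (auto simp: emb_def)
  next
    fix A p assume "A \<in> F" "p \<in> A"
    then obtain e i where e: "A = (\<lambda>j. e (length \<alpha> + j)) ` {..<length \<beta>}" "emb (\<lambda>j. e (length \<alpha> + j)) \<beta> \<pi>"
      "i < length \<beta>" "p = e (length \<alpha> + i)"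
      using emb_dsumD(2)[OF \<alpha> \<beta>(1)] by (auto simp: F_def)
    obtain j where j: "j < length \<beta>" "j < i \<or> \<beta> ! j < \<beta> ! i" using no_min[OF e(3)] by blast
    define q where "q = e (length \<alpha> + j)"
    have "q < p \<or> \<pi> ! q < \<pi> ! p" "p < length \<pi>" "q < length \<pi>"
      using e(2,3) j unfolding e(4) q_def by (auto simp: emb_def)
    then have "int q < int p \<or> ?y q < ?y p" using y_less by simp
    moreover have "q \<in> A" using e(1) j(1) by (simp add: q_def)
    ultimately show "\<exists>q\<in>A. int q < int p \<or> ?y q < ?y p" by blast
  next
    fix A A' p assume "A \<in> F" "A' \<in> F" "p \<in> A'"
    then obtain e e' i where e: "A = (\<lambda>j. e (length \<alpha> + j)) ` {..<length \<beta>}" "emb e (\<alpha> \<oplus>\<^sub>p \<beta>) \<pi>"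
      "emb e' (\<alpha> \<oplus>\<^sub>p \<beta>) \<pi>" "i < length \<beta>" "p = e' (length \<alpha> + i)"
      by (auto simp: F_def)
    note d = emb_dsumD[OF \<alpha> \<beta>(1) e(2)] and d' = emb_dsumD[OF \<alpha> \<beta>(1) e(3)]
    have p: "p < length \<pi>" using d'(2) e(4,5) by (simp add: emb_def)
    show "\<not> (\<forall>q\<in>A. int p < int q \<and> ?y p < ?y q)"
    proof
      assume dom: "\<forall>q\<in>A. int p < int q \<and> ?y p < ?y q"
      have "p < e (length \<alpha> + k) \<and> \<pi> ! p < \<pi> ! e (length \<alpha> + k)" if "k < length \<beta>" for k
      proof -
        have "e (length \<alpha> + k) \<in> A" "e (length \<alpha> + k) < length \<pi>"
          using d(2) that e(1) by (auto simp: emb_def)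
        then show ?thesis using dom y_less[of p "e (length \<alpha> + k)"] p by auto
      qed
      then have "\<alpha> \<oplus>\<^sub>p [Suc 0] \<oplus>\<^sub>p \<beta> \<preceq>\<^sub>p \<pi>"
        using involved_dsum_point[OF \<alpha> \<beta>(1) d'(1) d(2) p] d'(3)[OF _ e(4)] e(5) by blast
      then show False using \<pi>(2) by blast
    qed
  qed (use \<pi> perm I2_no321 perms_coordinates(2) in auto)
  then obtain c C D where c: "finite C" "finite D" "card C \<le> 6 * m + 1" "card D \<le> 6 * m + 1"
    "cut_by C int {..<length \<pi>} c" "cut_by D ?y {..<length \<pi>} c"
    "\<And>A. A \<in> F \<Longrightarrow> (\<exists>p\<in>A. c p) \<and> (\<exists>p\<in>A. \<not> c p)" by blast
  have "(\<exists>i<length (\<alpha> \<oplus>\<^sub>p \<beta>). c (e i)) \<and> (\<exists>i<length (\<alpha> \<oplus>\<^sub>p \<beta>). \<not> c (e i))"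
    if "emb e (\<alpha> \<oplus>\<^sub>p \<beta>) \<pi>" for e
  proof -
    have "(\<lambda>j. e (length \<alpha> + j)) ` {..<length \<beta>} \<in> F" using that by (auto simp: F_def)
    from c(7)[OF this] obtain i j where "i < length \<beta>" "c (e (length \<alpha> + i))"
      "j < length \<beta>" "\<not> c (e (length \<alpha> + j))" by auto
    then show ?thesis unfolding length_dsum by (meson add_strict_left_mono)
  qed
  with c(1-6) have "finite C \<and> finite D \<and> card C \<le> 6 * m + 1 \<and> card D \<le> 6 * m + 1 \<and>
     cut_by C int {..<length \<pi>} c \<and> cut_by D ?y {..<length \<pi>} c \<and>
     (\<forall>e. emb e (\<alpha> \<oplus>\<^sub>p \<beta>) \<pi> \<longrightarrow>
       (\<exists>i<length (\<alpha> \<oplus>\<^sub>p \<beta>). c (e i)) \<and> (\<exists>i<length (\<alpha> \<oplus>\<^sub>p \<beta>). \<not> c (e i)))"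
    by (intro conjI allI impI) auto
  then show ?thesis unfolding splittable_def by (intro exI)
qed

lemma growth_rate_remove_after:
  assumes "\<alpha> \<in> perms" "\<alpha> \<noteq> []" "\<beta> \<in> perms"
    "\<And>i. i < length \<alpha> \<Longrightarrow> \<exists>j<length \<alpha>. i < j \<or> \<alpha> ! i < \<alpha> ! j"
  shows "growth_rate (I2 \<inter> Av (insert (\<alpha> \<oplus>\<^sub>p [Suc 0] \<oplus>\<^sub>p \<beta>) Y)) \<le> growth_rate (I2 \<inter> Av (insert (\<alpha> \<oplus>\<^sub>p \<beta>) Y))"
  by (rule growth_rate_le_of_splittable, rule splittable_after[OF assms]) (auto simp: Av_def)

lemma growth_rate_remove_before:
  assumes "\<alpha> \<in> perms" "\<beta> \<in> perms" "\<beta> \<noteq> []"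
    "\<And>i. i < length \<beta> \<Longrightarrow> \<exists>j<length \<beta>. j < i \<or> \<beta> ! j < \<beta> ! i"
  shows "growth_rate (I2 \<inter> Av (insert (\<alpha> \<oplus>\<^sub>p [Suc 0] \<oplus>\<^sub>p \<beta>) Y)) \<le> growth_rate (I2 \<inter> Av (insert (\<alpha> \<oplus>\<^sub>p \<beta>) Y))"
  by (rule growth_rate_le_of_splittable, rule splittable_before[OF assms]) (auto simp: Av_def)

section \<open>Rigid reduction\<close>

text \<open>An entry that is both last and largest could be split off as a summand.\<close>

lemma indec_no_max_at_end:
  assumes "indec \<rho>" "2 \<le> length \<rho>" "i < length \<rho>"
  shows "\<exists>j<length \<rho>. i < j \<or> \<rho> ! i < \<rho> ! j"
proof (rule ccontr)
  assume no: "\<not> (\<exists>j<length \<rho>. i < j \<or> \<rho> ! i < \<rho> ! j)"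
  have \<rho>: "\<rho> \<in> perms" "\<rho> \<noteq> []" using assms(1) by (auto simp: indec_def)
  then have d: "distinct \<rho>" "set \<rho> = {1..length \<rho>}" by (auto simp: perms_iff)
  have "\<not> i < length \<rho> - 1" using no assms(2) by force
  then have i: "i = length \<rho> - 1" using assms(3) by simp
  have "length \<rho> \<in> set \<rho>" using d(2) assms(2) by auto
  then obtain j where "j < length \<rho>" "\<rho> ! j = length \<rho>" by (auto simp: in_set_conv_nth)
  then have "length \<rho> \<le> \<rho> ! i" using no by auto
  then have "\<rho> ! i = length \<rho>" using perms_nth[OF \<rho>(1) assms(3)] by simp
  then have last: "last \<rho> = length \<rho>" using \<rho>(2) i by (simp add: last_conv_nth)
  define \<sigma> where "\<sigma> = butlast \<rho>"
  have \<rho>_eq: "\<rho> = \<sigma> @ [length \<rho>]"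
    using append_butlast_last_id[OF \<rho>(2)] last by (simp add: \<sigma>_def)
  have len: "length \<rho> = Suc (length \<sigma>)" using assms(2) by (simp add: \<sigma>_def)
  have "set \<rho> = insert (length \<rho>) (set \<sigma>)" "length \<rho> \<notin> set \<sigma>" "distinct \<sigma>"
    using arg_cong[OF \<rho>_eq, of set] arg_cong[OF \<rho>_eq, of distinct] d(1) by auto
  then have "set \<sigma> = {1..length \<rho>} - {length \<rho>}" using d(2) by blast
  also have "\<dots> = {1..length \<sigma>}" using len by auto
  finally have "\<sigma> \<in> perms" using \<open>distinct \<sigma>\<close> by (simp add: perms_iff)
  moreover have "\<rho> = \<sigma> \<oplus>\<^sub>p [Suc 0]" using \<rho>_eq len by (simp add: dsum_def)
  moreover have "\<sigma> \<noteq> []" using len assms(2) by auto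
  ultimately show False
    using assms(1) one_perms unfolding indec_def plus_indecomposable_def by blast
qed

lemma indec_no_min_at_start:
  assumes "indec \<rho>" "2 \<le> length \<rho>" "i < length \<rho>"
  shows "\<exists>j<length \<rho>. j < i \<or> \<rho> ! j < \<rho> ! i"
proof (rule ccontr)
  assume no: "\<not> (\<exists>j<length \<rho>. j < i \<or> \<rho> ! j < \<rho> ! i)"
  have \<rho>: "\<rho> \<in> perms" using assms(1) by (auto simp: indec_def)
  have "\<not> 0 < i" using no assms(2) by force
  then have i: "i = 0" by simp
  have "1 \<in> set \<rho>" using \<rho> assms(2) by (auto simp: perms_iff)
  then obtain j where "j < length \<rho>" "\<rho> ! j = 1" by (auto simp: in_set_conv_nth)
  then have "\<rho> ! 0 \<le> 1" using no i by auto
  then have "\<rho> ! 0 = 1" using perms_nth[OF \<rho> assms(3)] i by simp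
  then have \<rho>_eq: "\<rho> = Suc 0 # tl \<rho>" using assms(2) by (cases \<rho>) auto
  define \<sigma> where "\<sigma> = map (\<lambda>v. v - 1) (tl \<rho>)"
  have "map (\<lambda>v. length [Suc 0] + v) \<sigma> = tl \<rho>" unfolding \<sigma>_def map_map
  proof (rule map_idI)
    fix v assume "v \<in> set (tl \<rho>)"
    then have "v \<in> set \<rho>" using \<rho>_eq by (metis list.set_intros(2))
    then have "1 \<le> v" using \<rho> by (auto simp: perms_iff)
    then show "((\<lambda>v. length [Suc 0] + v) \<circ> (\<lambda>v. v - 1)) v = v" by simp
  qed
  then have split: "\<rho> = [Suc 0] @ map (\<lambda>v. length [Suc 0] + v) \<sigma>" using \<rho>_eq by simp
  have "\<sigma> \<in> perms" by (rule shifted_perm[OF one_perms]) (use \<rho> split in simp)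
  moreover have "\<rho> = [Suc 0] \<oplus>\<^sub>p \<sigma>" using split by (simp add: dsum_def)
  moreover have "\<sigma> \<noteq> []" using split assms(2) by auto
  ultimately show False
    using assms(1) one_perms unfolding indec_def plus_indecomposable_def by blast
qed

abbreviation nontrivial :: "nat list \<Rightarrow> bool" where
  "nontrivial \<rho> \<equiv> 2 \<le> length \<rho>"

lemma indec_trivial: "indec \<rho> \<Longrightarrow> \<not> nontrivial \<rho> \<Longrightarrow> \<rho> = [Suc 0]"
  by (cases \<rho>) (auto simp: indec_def perms_iff not_less_eq_eq numeral_2_eq_2)

lemma indec_list_perms: "\<forall>\<rho>\<in>set xs. indec \<rho> \<Longrightarrow> dsum_list xs \<in> perms"
  by (rule dsum_list_perms) (auto simp: indec_def)

text \<open>The points are removed from left to right, so that the point in question always follows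
  directly after a component of length at least 2; whatever comes later is part of \<open>\<beta>\<close>.\<close>

lemma growth_rate_strip_after:
  assumes "rs \<noteq> []" "nontrivial (last rs)" "\<forall>\<rho>\<in>set (rs @ bs). indec \<rho>"
  shows "growth_rate (I2 \<inter> Av (insert (dsum_list (rs @ bs)) Y))
    \<le> growth_rate (I2 \<inter> Av (insert (dsum_list (rs @ filter nontrivial bs)) Y))"
  using assms
proof (induction bs arbitrary: rs)
  case (Cons b bs)
  show ?case
  proof (cases "nontrivial b")
    case True
    then show ?thesis using Cons.IH[of "rs @ [b]"] Cons.prems by simp
  next
    case False
    then have b: "b = [Suc 0]" using Cons.prems indec_trivial by simp
    define qs where "qs = butlast rs"
    define \<rho> where "\<rho> = last rs"
    have rs: "rs = qs @ [\<rho>]" using Cons.prems(1) by (simp add: qs_def \<rho>_def)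
    have \<rho>: "indec \<rho>" "nontrivial \<rho>" using Cons.prems(2,3) by (auto simp: rs)
    have \<alpha>: "dsum_list rs = dsum_list qs \<oplus>\<^sub>p \<rho>" by (simp add: rs dsum_list_append)
    have no_max: "\<exists>j<length (dsum_list rs). i < j \<or> dsum_list rs ! i < dsum_list rs ! j"
      if i: "i < length (dsum_list rs)" for i
    proof (cases "i < length (dsum_list qs)")
      case True
      then show ?thesis using \<rho>(2) by (intro exI[of _ "length (dsum_list qs)"]) (auto simp: \<alpha>)
    next
      case False
      then obtain i' where i': "i = length (dsum_list qs) + i'" "i' < length \<rho>"
        using i by (intro that[of "i - length (dsum_list qs)"]) (auto simp: \<alpha>)
      then obtain j where "j < length \<rho>" "i' < j \<or> \<rho> ! i' < \<rho> ! j"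
        using indec_no_max_at_end[OF \<rho>] by blast
      then show ?thesis using i'
        by (intro exI[of _ "length (dsum_list qs) + j"]) (auto simp: \<alpha> dsum_nth)
    qed
    have "dsum_list (rs @ b # bs) = dsum_list rs \<oplus>\<^sub>p [Suc 0] \<oplus>\<^sub>p dsum_list bs"
      by (simp add: b dsum_list_append)
    moreover have "growth_rate (I2 \<inter> Av (insert (dsum_list rs \<oplus>\<^sub>p [Suc 0] \<oplus>\<^sub>p dsum_list bs) Y))
        \<le> growth_rate (I2 \<inter> Av (insert (dsum_list rs \<oplus>\<^sub>p dsum_list bs) Y))"
    proof (rule growth_rate_remove_after)
      show "dsum_list rs \<in> perms" "dsum_list bs \<in> perms"
        using Cons.prems(3) by (auto intro!: indec_list_perms)
      show "dsum_list rs \<noteq> []" using \<rho>(2) by (auto simp: \<alpha> dsum_def)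
    qed (rule no_max)
    moreover have "dsum_list rs \<oplus>\<^sub>p dsum_list bs = dsum_list (rs @ bs)" by (simp add: dsum_list_append)
    moreover have "growth_rate (I2 \<inter> Av (insert (dsum_list (rs @ bs)) Y))
        \<le> growth_rate (I2 \<inter> Av (insert (dsum_list (rs @ filter nontrivial bs)) Y))"
      using Cons.IH[of rs] Cons.prems by simp
    ultimately show ?thesis using False by simp
  qed
qed simp

text \<open>The points in front of the first component \<open>\<rho>\<close> of length at least 2 are removed from right to left, the
  ones further to the left being part of \<open>\<alpha>\<close>.\<close>

lemma growth_rate_strip_before:
  assumes "nontrivial \<rho>" "\<forall>\<sigma>\<in>set (\<rho> # bs). indec \<sigma>"
  shows "growth_rate (I2 \<inter> Av (insert (dsum_list (replicate k [Suc 0] @ \<rho> # bs)) Y))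
    \<le> growth_rate (I2 \<inter> Av (insert (dsum_list (\<rho> # bs)) Y))"
proof (induction k)
  case (Suc k)
  define \<beta> where "\<beta> = \<rho> \<oplus>\<^sub>p dsum_list bs"
  have \<rho>: "indec \<rho>" using assms(2) by simp
  have no_min: "\<exists>j<length \<beta>. j < i \<or> \<beta> ! j < \<beta> ! i" if i: "i < length \<beta>" for i
  proof (cases "i < length \<rho>")
    case True
    then obtain j where "j < length \<rho>" "j < i \<or> \<rho> ! j < \<rho> ! i"
      using indec_no_min_at_start[OF \<rho> assms(1)] by blast
    then show ?thesis using True
      by (intro exI[of _ j]) (auto simp: \<beta>_def dsum_nth)
  next
    case False
    then show ?thesis using assms(1) by (intro exI[of _ 0]) (auto simp: \<beta>_def)
  qed
  have "dsum_list (replicate (Suc k) [Suc 0] @ \<rho> # bs) = dsum_list (replicate k [Suc 0]) \<oplus>\<^sub>p [Suc 0] \<oplus>\<^sub>p \<beta>"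
    unfolding replicate_Suc replicate_app_Cons_same[symmetric] append_Cons[symmetric]
    by (simp only: dsum_list_append dsum_list_simps append.assoc append_Cons append_Nil
      replicate_append_same[symmetric] dsum_assoc \<beta>_def)
  moreover have "growth_rate (I2 \<inter> Av (insert (dsum_list (replicate k [Suc 0]) \<oplus>\<^sub>p [Suc 0] \<oplus>\<^sub>p \<beta>) Y))
      \<le> growth_rate (I2 \<inter> Av (insert (dsum_list (replicate k [Suc 0]) \<oplus>\<^sub>p \<beta>) Y))"
  proof (rule growth_rate_remove_before)
    show "dsum_list (replicate k [Suc 0]) \<in> perms" by (rule dsum_list_perms) auto
    show "\<beta> \<in> perms" using indec_list_perms[of "\<rho> # bs"] assms(2) by (simp add: \<beta>_def)
    show "\<beta> \<noteq> []" using assms(1) by (auto simp: \<beta>_def dsum_def)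
  qed (rule no_min)
  moreover have "dsum_list (replicate k [Suc 0]) \<oplus>\<^sub>p \<beta> = dsum_list (replicate k [Suc 0] @ \<rho> # bs)"
    by (simp add: \<beta>_def dsum_list_append)
  ultimately show ?case using Suc.IH by simp
qed simp

lemma red_components:
  assumes "x \<in> perms"
  obtains xs where "\<forall>\<rho>\<in>set xs. indec \<rho>" "dsum_list xs = x" "red x = dsum_list (filter nontrivial xs)"
proof -
  obtain xs where xs: "\<forall>\<rho>\<in>set xs. indec \<rho>" "dsum_list xs = x"
    using indec_list_exists[OF assms] by blast
  obtain ps m where ps: "xs = flat ps m" "\<forall>(k, \<rho>)\<in>set ps. indec \<rho> \<and> length \<rho> \<ge> 2"
    using flat_exists[OF xs(1)] by blast
  then have "rigid_decomp x ps m"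
    using xs(2) by (auto simp: rigid_decomp_def dsum_list_flat indec_def)
  then have "red x = dsum_list (map snd ps)" by (rule red_eqI[OF assms])
  moreover have "filter nontrivial xs = map snd ps"
    unfolding ps(1) by (rule filter_flat) (use ps(2) in auto)
  ultimately show ?thesis using that xs by simp
qed

lemma red_involved:
  assumes "x \<in> perms"
  shows "red x \<preceq>\<^sub>p x"
proof -
  obtain xs where xs: "\<forall>\<rho>\<in>set xs. indec \<rho>" "dsum_list xs = x" "red x = dsum_list (filter nontrivial xs)"
    using red_components[OF assms] by blast
  have "dsum_list (filter nontrivial xs) \<preceq>\<^sub>p dsum_list xs" using xs(1)
  proof (induction xs)
    case Nil
    then show ?case by (simp add: involved_iff_emb emb_def)
  next
    case (Cons a xs)
    have a: "a \<in> perms" using Cons.prems by (simp add: indec_def)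
    have p: "dsum_list (filter nontrivial xs) \<in> perms" "dsum_list xs \<in> perms"
      using Cons.prems by (auto intro!: indec_list_perms)
    have "a \<preceq>\<^sub>p a" "[] \<preceq>\<^sub>p a" by (auto simp: involved_iff_emb emb_def intro!: exI[of _ "\<lambda>i. i"])
    then show ?case
      using dsum_involved_mono[OF a p(1) a p(2)] dsum_involved_mono[OF Nil_perms p(1) a p(2)] Cons
      by simp
  qed
  then show ?thesis using xs by simp
qed

lemma growth_rate_le_red:
  assumes "x \<in> perms" "red x \<noteq> []"
  shows "growth_rate (I2 \<inter> Av (insert x Y)) \<le> growth_rate (I2 \<inter> Av (insert (red x) Y))"
proof -
  obtain xs where xs: "\<forall>\<rho>\<in>set xs. indec \<rho>" "dsum_list xs = x" "red x = dsum_list (filter nontrivial xs)"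
    using red_components[OF assms(1)] by blast
  have "\<exists>\<rho>\<in>set xs. nontrivial \<rho>"
    using assms(2) xs(3) by (metis dsum_list_simps(1) filter_False)
  then obtain ys \<rho> zs where ys: "xs = ys @ \<rho> # zs" "nontrivial \<rho>" "\<forall>\<sigma>\<in>set ys. \<not> nontrivial \<sigma>"
    using split_list_first_prop[of xs nontrivial] by blast
  have ones: "ys = replicate (length ys) [Suc 0]"
    by (rule replicate_eqI) (use xs(1) ys indec_trivial in auto)
  have ind: "\<forall>\<sigma>\<in>set (\<rho> # zs). indec \<sigma>" using xs(1) ys by simp
  have "x = dsum_list (replicate (length ys) [Suc 0] @ \<rho> # zs)" using xs(2) ys(1) ones by simp
  moreover have "red x = dsum_list ([\<rho>] @ filter nontrivial zs)"
    using xs(3) ys by (simp add: filter_False)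
  ultimately show ?thesis
    using growth_rate_strip_before[OF ys(2) ind, of "length ys" Y]
      growth_rate_strip_after[of "[\<rho>]" zs Y] ys(2) ind by simp
qed

text \<open>The remaining forbidden patterns \<open>Y\<close> are arbitrary, so the elements of \<open>F\<close> can be reduced one after
  the other.\<close>

lemma growth_rate_le_red_image:
  assumes "finite F" "F \<subseteq> perms" "[] \<notin> red ` F"
  shows "growth_rate (I2 \<inter> Av (F \<union> Y)) \<le> growth_rate (I2 \<inter> Av (red ` F \<union> Y))"
  using assms
proof (induction F arbitrary: Y rule: finite_induct)
  case (insert x F)
  have "growth_rate (I2 \<inter> Av (insert x (F \<union> Y))) \<le> growth_rate (I2 \<inter> Av (insert (red x) (F \<union> Y)))"
    by (rule growth_rate_le_red) (use insert.prems in auto)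
  also have "insert (red x) (F \<union> Y) = F \<union> insert (red x) Y" by simp
  also have "growth_rate (I2 \<inter> Av (F \<union> insert (red x) Y)) \<le> growth_rate (I2 \<inter> Av (red ` F \<union> insert (red x) Y))"
    using insert.IH[of "insert (red x) Y"] insert.prems by simp
  finally show ?case by simp
qed simp

lemma ones_involved_in_increasing:
  assumes "I \<subseteq> {..<length \<pi>}" "k \<le> card I" "\<And>i j. i \<in> I \<Longrightarrow> j \<in> I \<Longrightarrow> i < j \<Longrightarrow> \<pi> ! i < \<pi> ! j"
  shows "[1..<Suc k] \<preceq>\<^sub>p \<pi>"
proof -
  let ?e = "\<lambda>i. sorted_list_of_set I ! i"
  have fin: "finite I" using assms(1) finite_subset by blast
  have mem: "?e i \<in> I" if "i < k" for i
    using nth_mem[of i "sorted_list_of_set I"] that assms(2) fin by simp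
  have less: "?e i < ?e j" if "i < j" "j < k" for i j
    using sorted_wrt_nth_less[OF strict_sorted_list_of_set[of I] that(1)] that(2) assms(2) by simp
  have "\<pi> ! ?e i < \<pi> ! ?e j \<longleftrightarrow> i < j" if "i < k" "j < k" for i j
    using that assms(3)[OF mem mem less] by (metis linorder_neqE_nat order_less_asym order_less_irrefl)
  moreover have "?e i < length \<pi>" if "i < k" for i using mem[OF that] assms(1) by auto
  ultimately have "emb ?e [1..<Suc k] \<pi>" using less by (auto simp: emb_def simp del: upt_Suc)
  then show ?thesis by (auto simp: involved_iff_emb)
qed

text \<open>The left-to-right maxima \<open>U\<close> increase. Two of the other entries in decreasing order would form 321
  together with an earlier larger entry, so the others increase as well; one of the two sets contains
  half of the entries.\<close>

lemma I2_long_involves_ones: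
  assumes "\<pi> \<in> I2" "2 * k \<le> length \<pi>"
  shows "[1..<Suc k] \<preceq>\<^sub>p \<pi>"
proof -
  have perm: "\<pi> \<in> perms" using assms(1) by (simp add: I2_def Av_def)
  then have d: "distinct \<pi>" by (simp add: perms_iff)
  note y_less = perms_coordinates(3)[OF perm]
  define U where "U = {i \<in> {..<length \<pi>}. \<forall>j<i. \<pi> ! j < \<pi> ! i}"
  define L where "L = {..<length \<pi>} - U"
  have U: "U \<subseteq> {..<length \<pi>}" by (auto simp: U_def)
  then have "finite U" by (rule finite_subset) simp
  then have "card U + card L = length \<pi>"
    using card_Diff_subset[OF _ U] card_mono[OF _ U] by (simp add: L_def)
  then consider "k \<le> card U" | "k \<le> card L" using assms(2) by linarith
  then show ?thesis
  proof cases
    case 1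
    then show ?thesis by (intro ones_involved_in_increasing[of U]) (auto simp: U_def)
  next
    case 2
    have "\<pi> ! i < \<pi> ! j" if ij: "i \<in> L" "j \<in> L" "i < j" for i j
    proof (rule ccontr)
      assume "\<not> \<pi> ! i < \<pi> ! j"
      moreover have len: "i < length \<pi>" "j < length \<pi>" using ij by (auto simp: L_def)
      moreover have "\<pi> ! i \<noteq> \<pi> ! j" using d len ij(3) by (simp add: nth_eq_iff_index_eq)
      ultimately have ji: "\<pi> ! j < \<pi> ! i" by simp
      obtain h where h: "h < i" "\<not> \<pi> ! h < \<pi> ! i" using ij(1) len by (auto simp: L_def U_def)
      moreover have "\<pi> ! h \<noteq> \<pi> ! i" using d len h(1) by (simp add: nth_eq_iff_index_eq)
      ultimately have "\<pi> ! i < \<pi> ! h" by simp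
      then have "\<pi> ! i - 1 < \<pi> ! h - 1" "\<pi> ! j - 1 < \<pi> ! i - 1"
        using ji len h(1) y_less[of i h] y_less[of j i] by simp_all
      then show False
        using no321D[OF I2_no321[OF assms(1)], of h i j] h(1) ij(3) len
          order_less_trans[OF h(1) len(1)] by (simp only: of_nat_less_iff lessThan_iff True_implies_equals)
    qed
    then show ?thesis using 2 by (intro ones_involved_in_increasing[of L]) (auto simp: L_def)
  qed
qed

lemma dsum_list_ones: "dsum_list (replicate k [Suc 0]) = [1..<Suc k]"
proof (induction k)
  case (Suc k)
  have "map Suc [1..<Suc k] = [2..<Suc (Suc k)]" by (simp only: map_Suc_upt numeral_2_eq_2 One_nat_def)
  moreover have "[1..<Suc (Suc k)] = 1 # [2..<Suc (Suc k)]"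
    by (simp only: numeral_2_eq_2 One_nat_def) (rule upt_conv_Cons, simp)
  ultimately show ?case using Suc by (simp add: dsum_def del: upt_Suc)
qed simp

theorem theorem5:
  fixes X :: "nat list set"
  assumes "finite X" and "X \<subseteq> perms"
  shows "growth_rate (I2 \<inter> Av X) = growth_rate (I2 \<inter> Av (red ` X))"
proof (cases "[] \<in> red ` X")
  case True
  then obtain x where x: "x \<in> X" "red x = []" by force
  obtain xs where xs: "\<forall>\<rho>\<in>set xs. indec \<rho>" "dsum_list xs = x" "red x = dsum_list (filter nontrivial xs)"
    using red_components[of x] x(1) assms(2) by blast
  have "filter nontrivial xs = []"
  proof (cases "filter nontrivial xs")
    case (Cons \<rho> \<rho>s)
    then have "\<rho> \<in> set (filter nontrivial xs)" by simp
    then have "nontrivial \<rho>" by simp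
    then show ?thesis using x(2) xs(3) Cons by (auto simp: dsum_def)
  qed
  then have "xs = replicate (length xs) [Suc 0]"
    using xs(1) indec_trivial by (intro replicate_eqI) (auto simp: filter_empty_conv)
  \<comment> \<open>If the reduction is empty, all components are single points and x is increasing.\<close>
  then have ones: "x = [1..<Suc (length xs)]" using xs(2) dsum_list_ones by metis
  have "length \<pi> < 2 * length xs" if "\<pi> \<in> I2 \<inter> Av X" for \<pi>
    using I2_long_involves_ones[of \<pi> "length xs"] that x(1) ones by (force simp: Av_def)
  then have "growth_rate (I2 \<inter> Av X) = 0" by (rule growth_rate_bounded_length)
  \<comment> \<open>The empty permutation is involved in everything, so nothing avoids the reduced set.\<close>
  moreover have "[] \<preceq>\<^sub>p \<pi>" for \<pi> by (simp add: involved_iff_emb emb_def)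
  then have "Av (red ` X) = {}" using True unfolding Av_def by blast
  then have "growth_rate (I2 \<inter> Av (red ` X)) = 0" by (intro growth_rate_bounded_length[of _ 0]) simp
  ultimately show ?thesis by simp
next
  case False
  show ?thesis
  proof (rule antisym)
    show "growth_rate (I2 \<inter> Av X) \<le> growth_rate (I2 \<inter> Av (red ` X))"
      using growth_rate_le_red_image[OF assms False, of "{}"] by simp
    have "Av (red ` X) \<subseteq> Av X"
      using red_involved involved_trans assms(2) by (fastforce simp: Av_def)
    then show "growth_rate (I2 \<inter> Av (red ` X)) \<le> growth_rate (I2 \<inter> Av X)"
      by (intro growth_rate_mono) blast
  qed
qed

end
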